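(* Let $\Gamma$ be a random edge-labelled graph on $n$ vertices with label probabilities $p_m=p_m(n)$. If $n^4p_2^4p_\infty^2\to\infty$ as $n\to\infty$, then $W_\Gamma$ is asymptotically almost surely not hyperbolic.
   Context: Random edge-labelled graph: for each $n$, nonnegative numbers $p_m(n)$ ($m=2,3,4,\dots$) are given with $\sum_{m=2}^\infty p_m(n)\le 1$. On a vertex set of size $n$, independently for each pair of vertices, the pair is joined by an edge labelled $m$ with probability $p_m(n)$ for each integer $m\ge2$, and is not joined by an edge with the remaining probability $p_\infty(n)=1-\sum_{m=2}^\infty p_m(n)$ (non-adjacent pairs are also said to be labelled $\infty$). "Asymptotically almost surely" means with probability tending to $1$ as $n\to\infty$. Coxeter group: if $\Gamma$ has vertices $v_1,\dots,v_n$ and the edge between $v_i$ and $v_j$ (if present) has label $m_{i,j}$, then $W_\Gamma=\langle v_1,\dots,v_n\mid v_i^2,\ (v_iv_j)^{m_{i,j}}\rangle$, with the second type of relator only for adjacent pairs. A group is hyperbolic if its Cayley graph with respect to some (hence any) finite generating set is $\delta$-hyperbolic for some $\delta\ge0$, i.e. in every geodesic triangle the $\delta$-neighborhood of the union of two sides contains the third side. *)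

theory Defs
  imports "HOL-Probability.Probability" "HOL-Algebra.Generated_Groups" "HOL-Library.Extended_Nat"
begin

section \<open>Groups given by generators and relators\<close>

text \<open>
  A letter \<open>(a, True)\<close> stands for the generator \<open>a\<close> and \<open>(a, False)\<close> for its formal inverse.
\<close>

type_synonym 'a word = "('a \<times> bool) list"

abbreviation words :: "'a set \<Rightarrow> 'a word set" where
  "words S \<equiv> lists (S \<times> UNIV)"

inductive pres_eq :: "'a set \<Rightarrow> 'a word set \<Rightarrow> 'a word \<Rightarrow> 'a word \<Rightarrow> bool"
  for S :: "'a set" and R :: "'a word set" where
  pres_refl: "w \<in> words S \<Longrightarrow> pres_eq S R w w"
| pres_sym: "pres_eq S R u v \<Longrightarrow> pres_eq S R v u"
| pres_trans: "pres_eq S R u v \<Longrightarrow> pres_eq S R v w \<Longrightarrow> pres_eq S R u w"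
| pres_cancel: "u \<in> words S \<Longrightarrow> v \<in> words S \<Longrightarrow> a \<in> S \<Longrightarrow>
    pres_eq S R (u @ [(a, b), (a, \<not> b)] @ v) (u @ v)"
| pres_relator: "u \<in> words S \<Longrightarrow> v \<in> words S \<Longrightarrow> r \<in> R \<Longrightarrow> pres_eq S R (u @ r @ v) (u @ v)"

definition pres_rel :: "'a set \<Rightarrow> 'a word set \<Rightarrow> 'a word rel" where
  "pres_rel S R = {(u, v). pres_eq S R u v}"

definition presented_group :: "'a set \<Rightarrow> 'a word set \<Rightarrow> 'a word set monoid" where
  "presented_group S R =
    \<lparr>carrier = words S // pres_rel S R,
     mult = (\<lambda>A B. \<Union>u\<in>A. \<Union>v\<in>B. pres_rel S R `` {u @ v}),
     one = pres_rel S R `` {[]}\<rparr>"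

lemma pres_eq_words:
  assumes "R \<subseteq> words S" "pres_eq S R u v"
  shows "u \<in> words S \<and> v \<in> words S"
  using assms(2,1) by induction auto

lemma equiv_pres_rel:
  assumes "R \<subseteq> words S"
  shows "equiv (words S) (pres_rel S R)"
proof (rule equivI)
  show "pres_rel S R \<subseteq> words S \<times> words S"
    using pres_eq_words[OF assms] unfolding pres_rel_def by blast
  show "refl_on (words S) (pres_rel S R)"
    by (rule refl_onI) (simp add: pres_rel_def pres_refl)
  show "sym_on UNIV (pres_rel S R)"
    by (rule symI) (simp add: pres_rel_def pres_sym)
  show "trans_on UNIV (pres_rel S R)"
    by (rule transI) (simp add: pres_rel_def, rule pres_trans)
qed

lemma pres_eq_append_left:
  assumes "pres_eq S R u v" "w \<in> words S"
  shows "pres_eq S R (w @ u) (w @ v)"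
  using assms
proof induction
  case (pres_cancel u v a b)
  then show ?case using pres_eq.pres_cancel[of "w @ u" S v a R b] by simp
next
  case (pres_relator u v r)
  then show ?case using pres_eq.pres_relator[of "w @ u" S v r R] by simp
next
  case (pres_refl v)
  then have "w @ v \<in> words S" by simp
  then show ?case by (rule pres_eq.pres_refl)
next
  case (pres_sym u v)
  then show ?case by (simp add: pres_eq.pres_sym)
next
  case (pres_trans u v x)
  then show ?case using pres_eq.pres_trans by metis
qed

lemma pres_eq_append_right:
  assumes "pres_eq S R u v" "w \<in> words S"
  shows "pres_eq S R (u @ w) (v @ w)"
  using assms
proof induction
  case (pres_cancel u v a b)
  then show ?case using pres_eq.pres_cancel[of u S "v @ w" a R b] by simp
next
  case (pres_relator u v r)
  then show ?case using pres_eq.pres_relator[of u S "v @ w" r R] by simp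
next
  case (pres_refl v)
  then have "v @ w \<in> words S" by simp
  then show ?case by (rule pres_eq.pres_refl)
next
  case (pres_sym u v)
  then show ?case by (simp add: pres_eq.pres_sym)
next
  case (pres_trans u v x)
  then show ?case using pres_eq.pres_trans by metis
qed

lemma presented_group_mult:
  assumes R: "R \<subseteq> words S" and uv: "u \<in> words S" "v \<in> words S"
  shows "(pres_rel S R `` {u}) \<otimes>\<^bsub>presented_group S R\<^esub> (pres_rel S R `` {v})
    = pres_rel S R `` {u @ v}"
proof -
  note E = equiv_pres_rel[OF R]
  have *: "pres_rel S R `` {u' @ v'} = pres_rel S R `` {u @ v}"
    if "pres_eq S R u u'" "pres_eq S R v v'" for u' v'
  proof (rule equiv_class_eq[OF E])
    have "pres_eq S R (u' @ v') (u @ v')"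
      using that pres_eq_words[OF R] by (metis pres_eq_append_right pres_sym)
    moreover have "pres_eq S R (u @ v') (u @ v)"
      using that uv by (metis pres_eq_append_left pres_sym)
    ultimately show "(u' @ v', u @ v) \<in> pres_rel S R"
      unfolding pres_rel_def by (simp, rule pres_trans)
  qed
  have "u \<in> pres_rel S R `` {u}" "v \<in> pres_rel S R `` {v}"
    using uv by (simp_all add: pres_rel_def pres_refl)
  moreover have "\<And>u' v'. u' \<in> pres_rel S R `` {u} \<Longrightarrow> v' \<in> pres_rel S R `` {v} \<Longrightarrow>
      pres_rel S R `` {u' @ v'} = pres_rel S R `` {u @ v}"
    using * by (auto simp: pres_rel_def)
  ultimately show ?thesis
    unfolding presented_group_def monoid.simps by blast
qed

lemma pres_eq_inverse:
  "w \<in> words S \<Longrightarrow> pres_eq S R (map (\<lambda>(a, b). (a, \<not> b)) (rev w) @ w) []"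
proof (induction w)
  case Nil
  then show ?case by (simp add: pres_refl)
next
  case (Cons l w)
  obtain a b where l: "l = (a, b)" by fastforce
  let ?i = "map (\<lambda>(a, b). (a, \<not> b)) (rev w)"
  have i: "?i \<in> words S" using Cons.prems by (fastforce simp: in_lists_conv_set)
  have "pres_eq S R (?i @ [(a, \<not> b), (a, \<not> \<not> b)] @ w) (?i @ w)"
    using i Cons.prems l by (intro pres_cancel) auto
  then have "pres_eq S R (?i @ [(a, \<not> b), (a, \<not> \<not> b)] @ w) []"
    by (rule pres_trans) (use Cons in simp)
  then show ?case by (simp add: l)
qed

lemma group_presented_group:
  assumes R: "R \<subseteq> words S"
  shows "group (presented_group S R)"
proof (rule groupI)
  let ?G = "presented_group S R" and ?c = "\<lambda>w. pres_rel S R `` {w}"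
  have carr: "A \<in> carrier ?G \<longleftrightarrow> (\<exists>w\<in>words S. A = ?c w)" for A
    by (auto simp: presented_group_def quotient_def)
  have one: "\<one>\<^bsub>?G\<^esub> = ?c []" by (simp add: presented_group_def)
  note m = presented_group_mult[OF R]
  show "\<one>\<^bsub>?G\<^esub> \<in> carrier ?G" by (force simp: carr one)
  show "A \<otimes>\<^bsub>?G\<^esub> B \<in> carrier ?G" if AB: "A \<in> carrier ?G" "B \<in> carrier ?G" for A B
  proof -
    obtain u v where uv: "u \<in> words S" "v \<in> words S" "A = ?c u" "B = ?c v"
      using AB unfolding carr by blast
    then have "u @ v \<in> words S" by simp
    then show ?thesis unfolding carr using uv m[of u v] by blast
  qed
  show "A \<otimes>\<^bsub>?G\<^esub> B \<otimes>\<^bsub>?G\<^esub> C = A \<otimes>\<^bsub>?G\<^esub> (B \<otimes>\<^bsub>?G\<^esub> C)"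
    if ABC: "A \<in> carrier ?G" "B \<in> carrier ?G" "C \<in> carrier ?G" for A B C
  proof -
    obtain u v w where "u \<in> words S" "v \<in> words S" "w \<in> words S" "A = ?c u" "B = ?c v" "C = ?c w"
      using ABC unfolding carr by blast
    then show ?thesis using m[of u v] m[of v w] m[of "u @ v" w] m[of u "v @ w"] by simp
  qed
  show "\<one>\<^bsub>?G\<^esub> \<otimes>\<^bsub>?G\<^esub> A = A" if A: "A \<in> carrier ?G" for A
  proof -
    obtain w where "w \<in> words S" "A = ?c w" using A unfolding carr by blast
    then show ?thesis using m[of "[]" w] one by simp
  qed
  show "\<exists>B\<in>carrier ?G. B \<otimes>\<^bsub>?G\<^esub> A = \<one>\<^bsub>?G\<^esub>" if A: "A \<in> carrier ?G" for A
  proof -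
    obtain w where w: "w \<in> words S" "A = ?c w" using A unfolding carr by blast
    let ?i = "map (\<lambda>(a, b). (a, \<not> b)) (rev w)"
    have i: "?i \<in> words S" using w by (fastforce simp: in_lists_conv_set)
    have "(?i @ w, []) \<in> pres_rel S R"
      using pres_eq_inverse[OF w(1)] by (simp add: pres_rel_def)
    then have "?c (?i @ w) = ?c []" by (rule equiv_class_eq[OF equiv_pres_rel[OF R]])
    then have "?c ?i \<otimes>\<^bsub>?G\<^esub> A = \<one>\<^bsub>?G\<^esub>" using m[OF i w(1)] w one by simp
    moreover have "?c ?i \<in> carrier ?G" unfolding carr using i by blast
    ultimately show ?thesis by blast
  qed
qed

section \<open>Edge-labelled graphs and Coxeter groups\<close>

text \<open>
  An edge-labelled graph on a vertex set \<open>V\<close> is a function on the two-element subsets of \<open>V\<close>;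
  the value \<open>\<infinity>\<close> means that the two vertices are not adjacent.
\<close>

type_synonym 'a labelled_graph = "'a set \<Rightarrow> enat"

definition vertex_pairs :: "'a set \<Rightarrow> 'a set set" where
  "vertex_pairs V = {e. e \<subseteq> V \<and> card e = 2}"

definition coxeter_relators :: "'a set \<Rightarrow> 'a labelled_graph \<Rightarrow> 'a word set" where
  "coxeter_relators V \<Gamma> =
    {[(v, True), (v, True)] | v. v \<in> V} \<union>
    {concat (replicate m [(v, True), (w, True)]) | v w m.
      v \<in> V \<and> w \<in> V \<and> v \<noteq> w \<and> \<Gamma> {v, w} = enat m}"

definition coxeter_group :: "'a set \<Rightarrow> 'a labelled_graph \<Rightarrow> 'a word set monoid" where
  "coxeter_group V \<Gamma> = presented_group V (coxeter_relators V \<Gamma>)"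

lemma coxeter_relators_words: "coxeter_relators V \<Gamma> \<subseteq> words V"
proof -
  have "concat (replicate m [(v, True), (w, True)]) \<in> words V" if "v \<in> V" "w \<in> V" for v w m
    using that by (induction m) auto
  moreover have "[(v, True), (v, True)] \<in> words V" if "v \<in> V" for v
    using that by simp
  ultimately show ?thesis unfolding coxeter_relators_def by blast
qed

lemma group_coxeter_group: "group (coxeter_group V \<Gamma>)"
  unfolding coxeter_group_def by (rule group_presented_group[OF coxeter_relators_words])

section \<open>The geometric realization of a graph\<close>

text \<open>
  A graph is given by a symmetric irreflexive edge relation. A point of its realization is given
  by barycentric coordinates: \<open>edge_point x y t\<close> lies on the edge from \<open>x\<close> to \<open>y\<close>, at distance
  \<open>t\<close> from \<open>x\<close>; the vertex \<open>x\<close> itself is \<open>edge_point x x 0\<close>.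
\<close>

definition edge_point :: "'a \<Rightarrow> 'a \<Rightarrow> real \<Rightarrow> 'a \<Rightarrow> real" where
  "edge_point x y t = (\<lambda>z. (1 - t) * of_bool (z = x) + t * of_bool (z = y))"

definition realization :: "'a set \<Rightarrow> 'a rel \<Rightarrow> ('a \<Rightarrow> real) set" where
  "realization V E = {edge_point x y t | x y t. x \<in> V \<and> y \<in> V \<and> (x, y) \<in> E\<^sup>= \<and> t \<in> {0..1}}"

definition graph_dist :: "'a rel \<Rightarrow> 'a \<Rightarrow> 'a \<Rightarrow> nat" where
  "graph_dist E x y = (LEAST n. (x, y) \<in> E ^^ n)"

text \<open>
  The length metric in which every edge is a unit interval. A shortest path from \<open>f\<close> to \<open>g\<close> either
  stays in one edge, or leaves the edge containing \<open>f\<close> through an end \<open>x\<close>, runs along edges to a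
  vertex \<open>y\<close>, and ends with a segment from \<open>y\<close> to \<open>g\<close> in an edge at \<open>y\<close>; these are the two kinds of
  lengths below. The case \<open>x = x'\<close> of \<open>(x, x') \<in> E\<^sup>=\<close> covers graphs without edges; the superfluous
  lengths it produces are nonnegative and dominate the true one, so they do not change the infimum.
  The value is meaningful for connected graphs only.
\<close>

definition path_lengths :: "'a rel \<Rightarrow> ('a \<Rightarrow> real) \<Rightarrow> ('a \<Rightarrow> real) \<Rightarrow> real set" where
  "path_lengths E f g =
    {\<bar>s - t\<bar> | s t x y. (x, y) \<in> E\<^sup>= \<and> s \<in> {0..1} \<and> t \<in> {0..1} \<and>
      f = edge_point x y s \<and> g = edge_point x y t} \<union>
    {s + real (graph_dist E x y) + t | s t x x' y y'.
      (x, x') \<in> E\<^sup>= \<and> (y, y') \<in> E\<^sup>= \<and> s \<in> {0..1} \<and> t \<in> {0..1} \<and>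
      f = edge_point x x' s \<and> g = edge_point y y' t}"

definition realization_dist :: "'a rel \<Rightarrow> ('a \<Rightarrow> real) \<Rightarrow> ('a \<Rightarrow> real) \<Rightarrow> real" where
  "realization_dist E f g = Inf (path_lengths E f g)"

lemma graph_dist_le: "(x, y) \<in> E ^^ n \<Longrightarrow> graph_dist E x y \<le> n"
  unfolding graph_dist_def by (rule Least_le)

lemma graph_dist_refl [simp]: "graph_dist E x x = 0"
  using graph_dist_le[of x x 0 E] by simp

lemma graph_dist_edge: "(x, y) \<in> E\<^sup>= \<Longrightarrow> graph_dist E x y \<le> 1"
  using graph_dist_le[of x y 1 E] by auto

lemma edge_point_flip: "edge_point x y t = edge_point y x (1 - t)"
  by (auto simp: edge_point_def)

lemma edge_point_same: "edge_point x x t = edge_point x x 0"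
  by (auto simp: edge_point_def)

lemma edge_point_0: "edge_point x y 0 = edge_point x x 0"
  by (auto simp: edge_point_def)

lemma path_lengths_cases:
  assumes "r \<in> path_lengths E f g"
  obtains (same) s t x y where "(x, y) \<in> E\<^sup>=" "s \<in> {0..1}" "t \<in> {0..1}"
      "f = edge_point x y s" "g = edge_point x y t" "r = \<bar>s - t\<bar>"
    | (via) s t x x' y y' where "(x, x') \<in> E\<^sup>=" "(y, y') \<in> E\<^sup>=" "s \<in> {0..1}" "t \<in> {0..1}"
      "f = edge_point x x' s" "g = edge_point y y' t" "r = s + real (graph_dist E x y) + t"
  using assms unfolding path_lengths_def by (elim UnE CollectE exE conjE) blast+

lemma path_lengths_sameI:
  assumes "(x, y) \<in> E\<^sup>=" "s \<in> {0..1}" "t \<in> {0..1}" "f = edge_point x y s" "g = edge_point x y t"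
  shows "\<bar>s - t\<bar> \<in> path_lengths E f g"
  unfolding path_lengths_def by (rule UnI1, rule CollectI, intro exI conjI, rule refl) (rule assms)+

lemma path_lengths_viaI:
  assumes "(x, x') \<in> E\<^sup>=" "(y, y') \<in> E\<^sup>=" "s \<in> {0..1}" "t \<in> {0..1}"
    "f = edge_point x x' s" "g = edge_point y y' t"
  shows "s + real (graph_dist E x y) + t \<in> path_lengths E f g"
  unfolding path_lengths_def by (rule UnI2, rule CollectI, intro exI conjI, rule refl) (rule assms)+

text \<open>Two descriptions of the same point agree up to orientation, unless the point is a vertex.\<close>

lemma edge_point_eq_cases:
  assumes "edge_point x y s = edge_point u v t" "s \<in> {0..1}" "t \<in> {0..1}"
  obtains (vertex) w where "edge_point x y s = edge_point w w 0"
      "w = x \<and> (s = 0 \<or> x = y) \<or> w = y \<and> s = 1" "w = u \<and> (t = 0 \<or> u = v) \<or> w = v \<and> t = 1"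
  | (same) "x \<noteq> y" "x = u" "y = v" "s = t"
  | (flip) "x \<noteq> y" "x = v" "y = u" "s = 1 - t"
proof -
  have eq: "(1 - s) * of_bool (z = x) + s * of_bool (z = y) =
      (1 - t) * of_bool (z = u) + t * of_bool (z = v)" for z
    using assms(1) by (simp add: edge_point_def fun_eq_iff)
  consider "x = y \<or> s = 0" | "x \<noteq> y" "s = 1" | "x \<noteq> y" "0 < s" "s < 1"
    using assms(2) by fastforce
  then show thesis
  proof cases
    case 1
    have "1 = (1 - t) * of_bool (x = u) + t * of_bool (x = v)"
      unfolding eq[symmetric] using 1 by auto
    then have "x = u \<and> (t = 0 \<or> u = v) \<or> x = v \<and> t = 1"
      by (simp add: of_bool_def split: if_splits)
    with 1 show thesis by (intro vertex[of x]) (auto simp: edge_point_def)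
  next
    case 2
    have "1 = (1 - t) * of_bool (y = u) + t * of_bool (y = v)"
      unfolding eq[symmetric] using 2 by auto
    then have "y = u \<and> (t = 0 \<or> u = v) \<or> y = v \<and> t = 1"
      by (simp add: of_bool_def split: if_splits)
    with 2 show thesis by (intro vertex[of y]) (auto simp: edge_point_def)
  next
    case 3
    then have "x = u \<and> y = v \<and> s = t \<or> x = v \<and> y = u \<and> s = 1 - t"
      using eq[of x] eq[of y] by (simp add: of_bool_def split: if_splits)
    with 3 same flip show thesis by blast
  qed
qed

context
  fixes V :: "'a set" and E :: "'a rel"
  assumes E: "E \<subseteq> V \<times> V" "sym E" "irrefl E"
    and connected: "\<And>x y. x \<in> V \<Longrightarrow> y \<in> V \<Longrightarrow> (x, y) \<in> E\<^sup>*"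
begin

lemma graph_dist_walk: "x \<in> V \<Longrightarrow> y \<in> V \<Longrightarrow> (x, y) \<in> E ^^ graph_dist E x y"
  using connected[of x y] unfolding graph_dist_def rtrancl_power by (auto intro: LeastI)

lemma relpow_sym: "(x, y) \<in> E ^^ n \<Longrightarrow> (y, x) \<in> E ^^ n"
proof (induction n arbitrary: x y)
  case (Suc n)
  then obtain z where "(x, z) \<in> E ^^ n" "(z, y) \<in> E" by auto
  then show ?case using Suc.IH E(2) by (metis relpow_Suc_I2 symD)
qed auto

lemma graph_dist_sym: "graph_dist E x y = graph_dist E y x"
  unfolding graph_dist_def using relpow_sym by metis

lemma graph_dist_triangle:
  assumes "x \<in> V" "y \<in> V" "z \<in> V"
  shows "graph_dist E x z \<le> graph_dist E x y + graph_dist E y z"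
  using assms by (intro graph_dist_le) (auto simp: relpow_add intro: graph_dist_walk)

lemma graph_dist_0: "x \<in> V \<Longrightarrow> y \<in> V \<Longrightarrow> graph_dist E x y = 0 \<longleftrightarrow> x = y"
  using graph_dist_walk[of x y] by auto

text \<open>\<open>exits_at f x s\<close>: the vertex \<open>x\<close> can be reached from \<open>f\<close> along one edge, at cost \<open>s\<close>.\<close>

definition exits_at :: "('a \<Rightarrow> real) \<Rightarrow> 'a \<Rightarrow> real \<Rightarrow> bool" where
  "exits_at f x s \<longleftrightarrow> x \<in> V \<and> s \<in> {0..1} \<and> (\<exists>x'. (x, x') \<in> E\<^sup>= \<and> f = edge_point x x' s)"

definition within_edge :: "('a \<Rightarrow> real) \<Rightarrow> ('a \<Rightarrow> real) \<Rightarrow> real \<Rightarrow> bool" where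
  "within_edge f g r \<longleftrightarrow> (\<exists>x y s t. x \<in> V \<and> (x, y) \<in> E\<^sup>= \<and> s \<in> {0..1} \<and> t \<in> {0..1} \<and>
    f = edge_point x y s \<and> g = edge_point x y t \<and> r = \<bar>s - t\<bar>)"

lemma edge_sym: "(x, y) \<in> E\<^sup>= \<Longrightarrow> (y, x) \<in> E\<^sup>="
  using E(2) by (auto dest: symD)

lemma edge_vertices: "(x, y) \<in> E\<^sup>= \<Longrightarrow> x \<in> V \<longleftrightarrow> y \<in> V"
  using E(1) by auto

lemma edge_point_realization:
  assumes "edge_point x y t \<in> realization V E" "(x, y) \<in> E\<^sup>=" "t \<in> {0..1}"
  shows "x \<in> V"
proof -
  obtain u v s where *: "edge_point x y t = edge_point u v s" "u \<in> V" "v \<in> V" "s \<in> {0..1}"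
    using assms(1) by (auto simp: realization_def)
  from *(1) assms(3) *(4) show ?thesis
    by (cases rule: edge_point_eq_cases) (use * assms(2) edge_vertices in auto)
qed

lemma path_lengths_iff:
  assumes "f \<in> realization V E" "g \<in> realization V E"
  shows "r \<in> path_lengths E f g \<longleftrightarrow>
    within_edge f g r \<or> (\<exists>x y s t. exits_at f x s \<and> exits_at g y t \<and> r = s + real (graph_dist E x y) + t)"
    (is "_ \<longleftrightarrow> ?rhs")
proof
  assume "r \<in> path_lengths E f g"
  then show ?rhs
  proof (cases rule: path_lengths_cases)
    case (same s t x y)
    then have "x \<in> V" using assms edge_point_realization by metis
    with same have "within_edge f g r" unfolding within_edge_def by metis
    then show ?thesis ..
  next
    case (via s t x x' y y')
    then have "x \<in> V" "y \<in> V" using assms edge_point_realization by metis+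
    with via have "exits_at f x s" "exits_at g y t" unfolding exits_at_def by metis+
    with via(7) show ?thesis by blast
  qed
next
  assume ?rhs
  then show "r \<in> path_lengths E f g"
  proof (elim disjE exE conjE)
    assume "within_edge f g r"
    then show ?thesis unfolding within_edge_def by (metis path_lengths_sameI)
  next
    fix x y s t
    assume "exits_at f x s" "exits_at g y t" "r = s + real (graph_dist E x y) + t"
    then show ?thesis unfolding exits_at_def by (metis path_lengths_viaI)
  qed
qed

lemma exits_at_ex: "f \<in> realization V E \<Longrightarrow> \<exists>x s. exits_at f x s"
  unfolding realization_def exits_at_def by blast

lemma exits_at_dist:
  assumes "exits_at f x s" "exits_at f y t"
  shows "real (graph_dist E x y) \<le> s + t"
proof -
  obtain x' y' where *: "x \<in> V" "y \<in> V" "s \<in> {0..1}" "t \<in> {0..1}" "(x, x') \<in> E\<^sup>="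
      "(y, y') \<in> E\<^sup>=" "f = edge_point x x' s" "f = edge_point y y' t"
    using assms unfolding exits_at_def by metis
  have "edge_point x x' s = edge_point y y' t" using * by simp
  then show ?thesis using *(3,4)
  proof (cases rule: edge_point_eq_cases)
    case (vertex w)
    have "w \<in> V" using vertex * edge_vertices by auto
    have "real (graph_dist E x w) \<le> s"
      using vertex(2) graph_dist_edge[OF *(5)] *(3) by auto
    moreover have "real (graph_dist E w y) \<le> t"
      using vertex(3) graph_dist_edge[OF edge_sym[OF *(6)]] *(4) by auto
    ultimately show ?thesis using graph_dist_triangle[OF *(1) \<open>w \<in> V\<close> *(2)] by linarith
  next
    case flip
    then show ?thesis using graph_dist_edge[OF *(5)] by simp
  qed (use * in auto)
qed

lemma within_edge_sym: "within_edge f g r \<Longrightarrow> within_edge g f r"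
  unfolding within_edge_def by (metis abs_minus_commute)

lemma within_edge_vertex:
  assumes "within_edge f g r" "g = edge_point w w 0" "w \<in> V"
  shows "exits_at f w r \<or> f = g"
proof -
  obtain x y s t where *: "x \<in> V" "(x, y) \<in> E\<^sup>=" "s \<in> {0..1}" "t \<in> {0..1}"
      "f = edge_point x y s" "g = edge_point x y t" "r = \<bar>s - t\<bar>"
    using assms(1) by (auto simp only: within_edge_def)
  have "edge_point x y t = edge_point w w 0" using * assms by simp
  then have "w = x \<and> (t = 0 \<or> x = y) \<or> w = y \<and> t = 1"
    by (cases rule: edge_point_eq_cases) (use * in auto)
  then show ?thesis
  proof (elim disjE conjE)
    assume "w = x" "t = 0"
    then show ?thesis using * by (auto simp: exits_at_def)
  next
    assume "w = y" "t = 1"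
    moreover have "f = edge_point y x (1 - s)" using * edge_point_flip by metis
    ultimately show ?thesis using * edge_sym[OF *(2)] assms(3) unfolding exits_at_def
      by (intro disjI1 conjI exI[of _ x]) auto
  next
    assume "w = x" "x = y"
    then show ?thesis using * edge_point_same by metis
  qed
qed

lemma within_edge_nonneg: "within_edge f g r \<Longrightarrow> 0 \<le> r"
  by (auto simp: within_edge_def)

lemma within_edge_out:
  assumes "within_edge f g r" "exits_at g z c"
  shows "\<exists>w b. exits_at f w b \<and> b + real (graph_dist E w z) \<le> r + c"
proof -
  obtain x y s t where *: "x \<in> V" "(x, y) \<in> E\<^sup>=" "s \<in> {0..1}" "t \<in> {0..1}"
      "f = edge_point x y s" "g = edge_point x y t" "r = \<bar>s - t\<bar>"
    using assms(1) by (auto simp only: within_edge_def)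
  obtain z' where z: "z \<in> V" "c \<in> {0..1}" "(z, z') \<in> E\<^sup>=" "g = edge_point z z' c"
    using assms(2) by (auto simp only: exits_at_def)
  have yV: "y \<in> V" using * edge_vertices by blast
  have o1: "exits_at f x s" unfolding exits_at_def using * by blast
  have o2: "exits_at f y (1 - s)" unfolding exits_at_def
    using * yV edge_sym[OF *(2)] edge_point_flip[of x y s] by auto
  have "edge_point x y t = edge_point z z' c" using * z by simp
  then show ?thesis using *(4) z(2)
  proof (cases rule: edge_point_eq_cases)
    case (vertex w)
    have w: "w \<in> V" "g = edge_point w w 0" using vertex * yV by auto
    have wz: "real (graph_dist E w z) \<le> c"
      using vertex(3) graph_dist_edge[OF edge_sym[OF z(3)]] z(2) by auto
    from within_edge_vertex[OF assms(1) w(2,1)] show ?thesis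
    proof
      assume "exits_at f w r"
      then show ?thesis using wz by (intro exI[of _ w] exI[of _ r]) auto
    next
      assume "f = g"
      then show ?thesis using assms(2) within_edge_nonneg[OF assms(1)] by (intro exI[of _ z] exI[of _ c]) auto
    qed
  next
    case same
    then show ?thesis using o1 * by (intro exI[of _ x] exI[of _ s]) auto
  next
    case flip
    then show ?thesis using o2 * by (intro exI[of _ y] exI[of _ "1 - s"]) auto
  qed
qed

lemma path_lengths_sym:
  assumes "r \<in> path_lengths E f g"
  shows "r \<in> path_lengths E g f"
  using assms
proof (cases rule: path_lengths_cases)
  case same
  then show ?thesis by (metis path_lengths_sameI abs_minus_commute)
next
  case (via s t x x' y y')
  then have "r = t + real (graph_dist E y x) + s" using graph_dist_sym[of x y] by simp
  with via show ?thesis by (metis path_lengths_viaI)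
qed

lemma path_lengths_triangle:
  assumes M: "f \<in> realization V E" "g \<in> realization V E" "h \<in> realization V E"
    and ab: "a \<in> path_lengths E f g" "b \<in> path_lengths E g h"
  shows "\<exists>c\<in>path_lengths E f h. c \<le> a + b"
proof -
  note iff = path_lengths_iff[OF M(1,2)] path_lengths_iff[OF M(2,3)] path_lengths_iff[OF M(1,3)]
  have step: "\<exists>c\<in>path_lengths E f h. c \<le> a + b"
    if fh: "f \<in> realization V E" "h \<in> realization V E" "within_edge f g a"
      and o: "exits_at g x s" "exits_at h y t" "b = s + real (graph_dist E x y) + t"
    for f h a b x y s t
  proof -
    obtain w c where w: "exits_at f w c" "c + real (graph_dist E w x) \<le> a + s"
      using within_edge_out[OF fh(3) o(1)] by blast
    have "c + real (graph_dist E w y) + t \<in> path_lengths E f h"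
      using w o path_lengths_iff[OF fh(1,2)] by blast
    moreover have "graph_dist E w y \<le> graph_dist E w x + graph_dist E x y"
      using w o by (intro graph_dist_triangle) (auto simp: exits_at_def)
    ultimately show ?thesis using w o by (intro bexI) auto
  qed
  consider (ii) "within_edge f g a" "within_edge g h b"
    | (io) x y s t where "within_edge f g a" "exits_at g x s" "exits_at h y t" "b = s + real (graph_dist E x y) + t"
    | (oi) x y s t where "within_edge g h b" "exits_at f x s" "exits_at g y t" "a = s + real (graph_dist E x y) + t"
    | (oo) x y s t x' y' s' t' where "exits_at f x s" "exits_at g y t" "a = s + real (graph_dist E x y) + t"
        "exits_at g x' s'" "exits_at h y' t'" "b = s' + real (graph_dist E x' y') + t'"
    using ab unfolding iff by metis
  then show ?thesis
  proof cases
    case io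
    then show ?thesis using step[of f h a] M by blast
  next
    case oi
    then have "\<exists>c\<in>path_lengths E h f. c \<le> b + a"
      using M within_edge_sym graph_dist_sym by (intro step[of h f b y t x s]) auto
    then show ?thesis using path_lengths_sym by (auto simp: add.commute)
  next
    case oo
    have "s + real (graph_dist E x y') + t' \<in> path_lengths E f h" using oo iff by blast
    moreover have "real (graph_dist E y x') \<le> t + s'" using oo exits_at_dist by blast
    moreover have "graph_dist E x y' \<le> graph_dist E x y + graph_dist E y y'"
      "graph_dist E y y' \<le> graph_dist E y x' + graph_dist E x' y'"
      using oo by (auto simp: exits_at_def intro: graph_dist_triangle)
    ultimately show ?thesis using oo by (intro bexI) auto
  next
    case ii
    obtain x y s t where i: "x \<in> V" "(x, y) \<in> E\<^sup>=" "s \<in> {0..1}" "t \<in> {0..1}"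
        "f = edge_point x y s" "g = edge_point x y t" "a = \<bar>s - t\<bar>"
      using ii(1) by (auto simp only: within_edge_def)
    obtain u v c d where j: "u \<in> V" "(u, v) \<in> E\<^sup>=" "c \<in> {0..1}" "d \<in> {0..1}"
        "g = edge_point u v c" "h = edge_point u v d" "b = \<bar>c - d\<bar>"
      using ii(2) by (auto simp only: within_edge_def)
    have "edge_point x y t = edge_point u v c" using i j by simp
    then show ?thesis using i(4) j(3)
    proof (cases rule: edge_point_eq_cases)
      case (vertex w)
      have w: "w \<in> V" "g = edge_point w w 0" using vertex i edge_vertices by auto
      from within_edge_vertex[OF ii(1) w(2,1)] within_edge_vertex[OF within_edge_sym[OF ii(2)] w(2,1)]
      consider "exits_at f w a" "exits_at h w b" | "f = g" | "h = g" by blast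
      then show ?thesis
      proof cases
        case 1
        then have "a + real (graph_dist E w w) + b \<in> path_lengths E f h" using iff by blast
        then show ?thesis by (intro bexI) auto
      next
        case 2
        then show ?thesis using ab within_edge_nonneg[OF ii(1)] by (intro bexI[of _ b]) auto
      next
        case 3
        then show ?thesis using ab within_edge_nonneg[OF ii(2)] by (intro bexI[of _ a]) auto
      qed
    next
      case same
      then have "within_edge f h \<bar>s - d\<bar>" using i j by (auto simp only: within_edge_def)
      then show ?thesis using iff i j same by (intro bexI[of _ "\<bar>s - d\<bar>"]) auto
    next
      case flip
      have "h = edge_point x y (1 - d)" using flip j edge_point_flip by metis
      then have "within_edge f h \<bar>s - (1 - d)\<bar>" unfolding within_edge_def using i j
        by (intro exI[of _ x] exI[of _ y] exI[of _ s] exI[of _ "1 - d"]) auto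
      then show ?thesis using iff i j flip by (intro bexI[of _ "\<bar>s - (1 - d)\<bar>"]) auto
    qed
  qed
qed

lemma path_lengths_bound:
  assumes "f \<in> realization V E" "g \<in> realization V E" "r \<in> path_lengths E f g"
  shows "\<bar>f z - g z\<bar> \<le> r"
proof -
  have *: "\<bar>edge_point x y s z - edge_point x y t z\<bar> \<le> \<bar>s - t\<bar>" for x y s t
    by (auto simp: edge_point_def of_bool_def)
  have o: "\<bar>f z - of_bool (z = x)\<bar> \<le> s" "0 \<le> f z" "f z \<le> 1" if "exits_at f x s" for f x s
    using that by (auto simp: exits_at_def edge_point_def of_bool_def)
  from assms(3) consider "within_edge f g r"
    | x y s t where "exits_at f x s" "exits_at g y t" "r = s + real (graph_dist E x y) + t"
    unfolding path_lengths_iff[OF assms(1,2)] by blast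
  then show ?thesis
  proof cases
    case 1
    then show ?thesis using * by (auto simp only: within_edge_def)
  next
    case 2
    show ?thesis
    proof (cases "x = y")
      case True
      then show ?thesis using 2 o(1)[OF 2(1)] o(1)[OF 2(2)] by auto
    next
      case False
      then have "1 \<le> real (graph_dist E x y)"
        using 2 graph_dist_0[of x y] by (simp add: exits_at_def Suc_le_eq)
      moreover have "0 \<le> s" "0 \<le> t" using 2 by (auto simp: exits_at_def)
      ultimately show ?thesis using 2 o(2,3)[OF 2(1)] o(2,3)[OF 2(2)] by auto
    qed
  qed
qed

lemma path_lengths_nonempty:
  assumes "f \<in> realization V E" "g \<in> realization V E"
  shows "path_lengths E f g \<noteq> {}"
  using exits_at_ex[OF assms(1)] exits_at_ex[OF assms(2)] path_lengths_iff[OF assms] by blast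

lemma realization_dist_le: "r \<in> path_lengths E f g \<Longrightarrow> realization_dist E f g \<le> r"
  unfolding realization_dist_def
  by (rule cInf_lower) (auto simp: path_lengths_def intro!: bdd_belowI[of _ 0])

lemma realization_dist_greatest:
  assumes "f \<in> realization V E" "g \<in> realization V E"
    and "\<And>r. r \<in> path_lengths E f g \<Longrightarrow> b \<le> r"
  shows "b \<le> realization_dist E f g"
  unfolding realization_dist_def using assms path_lengths_nonempty by (intro cInf_greatest) auto

lemma Metric_space_realization:
  "Metric_space (realization V E)
    (\<lambda>f g. if f \<in> realization V E \<and> g \<in> realization V E then realization_dist E f g else 0)"
proof -
  let ?M = "realization V E" and ?P = "path_lengths E" and ?d = "realization_dist E"
  have nonneg: "0 \<le> ?d f g" if "f \<in> ?M" "g \<in> ?M" for f g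
    using that by (rule realization_dist_greatest) (auto simp: path_lengths_def)
  have sym: "?d f g = ?d g f" for f g
    unfolding realization_dist_def using path_lengths_sym by (metis subsetI subset_antisym)
  have zero: "?d f g = 0 \<longleftrightarrow> f = g" if "f \<in> ?M" "g \<in> ?M" for f g
  proof
    assume "?d f g = 0"
    moreover have "\<bar>f z - g z\<bar> \<le> ?d f g" for z
      using that path_lengths_bound by (intro realization_dist_greatest) auto
    ultimately show "f = g" by (intro ext) auto
  next
    assume "f = g"
    obtain x y t where "f = edge_point x y t" "(x, y) \<in> E\<^sup>=" "t \<in> {0..1}"
      using \<open>f \<in> ?M\<close> unfolding realization_def by blast
    then have "\<bar>t - t\<bar> \<in> ?P f f" by (intro path_lengths_sameI)
    then have "?d f f \<le> 0" using realization_dist_le by fastforce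
    then show "?d f g = 0" using nonneg that \<open>f = g\<close> by fastforce
  qed
  have triangle: "?d f h \<le> ?d f g + ?d g h" if M: "f \<in> ?M" "g \<in> ?M" "h \<in> ?M" for f g h
  proof -
    have le: "?d f h \<le> a + b" if "a \<in> ?P f g" "b \<in> ?P g h" for a b
      using path_lengths_triangle[OF M that] realization_dist_le order_trans by blast
    have "?d f h - a \<le> ?d g h" if "a \<in> ?P f g" for a
      using le[OF that] M by (intro realization_dist_greatest) (auto simp: algebra_simps)
    then have "?d f h - ?d g h \<le> ?d f g"
      using M by (intro realization_dist_greatest) (auto simp: algebra_simps)
    then show ?thesis by simp
  qed
  show ?thesis
    by unfold_locales (auto simp: nonneg zero triangle sym)
qed

lemma realization_dist_vertices:
  assumes "x \<in> V" "y \<in> V"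
  shows "realization_dist E (edge_point x x 0) (edge_point y y 0) = real (graph_dist E x y)"
proof -
  let ?f = "edge_point x x 0" and ?g = "edge_point y y 0"
  have M: "?f \<in> realization V E" "?g \<in> realization V E"
    using assms unfolding realization_def by fastforce+
  have o: "exits_at ?f x 0" "exits_at ?g y 0" using assms by (auto simp: exits_at_def)
  then have "0 + real (graph_dist E x y) + 0 \<in> path_lengths E ?f ?g"
    using path_lengths_iff[OF M] by blast
  then have "realization_dist E ?f ?g \<le> real (graph_dist E x y)"
    using realization_dist_le by fastforce
  moreover have "real (graph_dist E x y) \<le> r" if "r \<in> path_lengths E ?f ?g" for r
    using that unfolding path_lengths_iff[OF M]
  proof (elim disjE exE conjE)
    assume "within_edge ?f ?g r"
    then obtain w b where "exits_at ?f w b" "b + real (graph_dist E w y) \<le> r + 0"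
      using within_edge_out[OF _ o(2)] by blast
    moreover have "graph_dist E x y \<le> graph_dist E x w + graph_dist E w y"
      using assms \<open>exits_at ?f w b\<close> by (intro graph_dist_triangle) (auto simp: exits_at_def)
    ultimately show ?thesis using exits_at_dist[OF o(1)] by fastforce
  next
    fix u v s t
    assume *: "exits_at ?f u s" "exits_at ?g v t" "r = s + real (graph_dist E u v) + t"
    have "graph_dist E x y \<le> graph_dist E x u + graph_dist E u y"
      "graph_dist E u y \<le> graph_dist E u v + graph_dist E v y"
      using * assms by (auto simp: exits_at_def intro: graph_dist_triangle)
    then show ?thesis using exits_at_dist[OF o(1) *(1)] exits_at_dist[OF *(2) o(2)] * by simp
  qed
  then have "real (graph_dist E x y) \<le> realization_dist E ?f ?g"
    by (rule realization_dist_greatest[OF M])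
  ultimately show ?thesis by simp
qed

end

section \<open>Hyperbolicity\<close>

text \<open>Here and below, a metric space is given by its set of points and its distance function.\<close>

definition geodesic_segment ::
    "'b set \<Rightarrow> ('b \<Rightarrow> 'b \<Rightarrow> real) \<Rightarrow> 'b \<Rightarrow> 'b \<Rightarrow> 'b set \<Rightarrow> bool" where
  "geodesic_segment M d x y A \<longleftrightarrow>
    (\<exists>\<gamma> L. 0 \<le> L \<and> \<gamma> ` {0..L} \<subseteq> M \<and> \<gamma> 0 = x \<and> \<gamma> L = y \<and> A = \<gamma> ` {0..L} \<and>
      (\<forall>s\<in>{0..L}. \<forall>t\<in>{0..L}. d (\<gamma> s) (\<gamma> t) = \<bar>s - t\<bar>))"

definition delta_hyperbolic :: "'b set \<Rightarrow> ('b \<Rightarrow> 'b \<Rightarrow> real) \<Rightarrow> real \<Rightarrow> bool" where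
  "delta_hyperbolic M d \<delta> \<longleftrightarrow>
    (\<forall>x y z A B C.
      geodesic_segment M d x y A \<and> geodesic_segment M d y z B \<and> geodesic_segment M d x z C \<longrightarrow>
      (\<forall>c\<in>C. \<exists>q\<in>A \<union> B. d c q \<le> \<delta>))"

definition cayley_edges :: "('g, 'm) monoid_scheme \<Rightarrow> 'g set \<Rightarrow> 'g rel" where
  "cayley_edges G S = {(g, h). g \<in> carrier G \<and> h \<in> carrier G \<and> g \<noteq> h \<and>
    (\<exists>s\<in>S. h = g \<otimes>\<^bsub>G\<^esub> s \<or> g = h \<otimes>\<^bsub>G\<^esub> s)}"

definition hyperbolic_group :: "('g, 'm) monoid_scheme \<Rightarrow> bool" where
  "hyperbolic_group G \<longleftrightarrow>
    (\<exists>S. finite S \<and> S \<subseteq> carrier G \<and> generate G S = carrier G \<and>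
      (\<exists>\<delta>\<ge>0. delta_hyperbolic (realization (carrier G) (cayley_edges G S))
        (realization_dist (cayley_edges G S)) \<delta>))"

section \<open>Random edge-labelled graphs\<close>

text \<open>Only the values \<open>q m\<close> with \<open>m \<ge> 2\<close> matter.\<close>

definition p_infinity :: "(nat \<Rightarrow> real) \<Rightarrow> real" where
  "p_infinity q = 1 - (\<Sum>\<^sub>\<infinity>m\<in>{2..}. q m)"

definition label_probs :: "(nat \<Rightarrow> real) \<Rightarrow> bool" where
  "label_probs q \<longleftrightarrow> (\<forall>m\<ge>2. 0 \<le> q m) \<and> q summable_on {2..} \<and> (\<Sum>\<^sub>\<infinity>m\<in>{2..}. q m) \<le> 1"

definition label_prob :: "(nat \<Rightarrow> real) \<Rightarrow> enat \<Rightarrow> real" where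
  "label_prob q l = (case l of enat m \<Rightarrow> if 2 \<le> m then q m else 0 | \<infinity> \<Rightarrow> p_infinity q)"

definition label_pmf :: "(nat \<Rightarrow> real) \<Rightarrow> enat pmf" where
  "label_pmf q = embed_pmf (label_prob q)"

definition random_labelled_graph :: "nat \<Rightarrow> (nat \<Rightarrow> real) \<Rightarrow> nat labelled_graph pmf" where
  "random_labelled_graph n q = Pi_pmf (vertex_pairs {..<n}) \<infinity> (\<lambda>_. label_pmf q)"

lemma pmf_label_pmf:
  assumes "label_probs q"
  shows "pmf (label_pmf q) l = label_prob q l"
  unfolding label_pmf_def
proof (rule pmf_embed_pmf)
  have nonneg: "0 \<le> label_prob q l" for l
    using assms by (auto simp: label_prob_def label_probs_def p_infinity_def split: enat.split)
  then show "\<And>l. 0 \<le> label_prob q l" .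
  have "(q has_sum (\<Sum>\<^sub>\<infinity>m\<in>{2..}. q m)) {2..}"
    using assms by (simp add: label_probs_def)
  then have "((label_prob q \<circ> enat) has_sum (\<Sum>\<^sub>\<infinity>m\<in>{2..}. q m)) {2..}"
    by (rule has_sum_cong[THEN iffD1, rotated]) (auto simp: label_prob_def)
  then have "(label_prob q has_sum (\<Sum>\<^sub>\<infinity>m\<in>{2..}. q m)) (enat ` {2..})"
    by (subst has_sum_reindex) (auto simp: inj_on_def)
  then have "(label_prob q has_sum ((\<Sum>\<^sub>\<infinity>m\<in>{2..}. q m) + label_prob q \<infinity>))
      (enat ` {2..} \<union> {\<infinity>})"
    by (rule has_sum_Un_disjoint) (auto intro: has_sum_finiteI)
  then have "(label_prob q has_sum 1) (enat ` {2..} \<union> {\<infinity>})"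
    by (simp add: label_prob_def p_infinity_def)
  then have sum1: "(label_prob q has_sum 1) UNIV"
  proof (rule has_sum_cong_neutral[THEN iffD1, rotated -1])
    show "label_prob q l = 0" if "l \<in> UNIV - (enat ` {2..} \<union> {\<infinity>})" for l
      using that by (cases l) (auto simp: label_prob_def)
  qed auto
  then have "integrable (count_space UNIV) (label_prob q)"
    using nonneg by (auto simp: abs_summable_on_def[symmetric] abs_summable_equivalent[symmetric]
        dest: has_sum_imp_summable)
  moreover have "(\<Sum>\<^sub>\<infinity>l. label_prob q l) = 1" using sum1 by (rule infsumI)
  ultimately show "(\<integral>\<^sup>+ l. ennreal (label_prob q l) \<partial>count_space UNIV) = 1"
    using nonneg by (subst nn_integral_eq_integral)
      (auto simp: infsetsum_def[symmetric] abs_summable_on_def[symmetric] infsetsum_infsum)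
qed

end

theory Submission
  imports Defs
begin

text \<open>
  Call four vertices \<open>a, b, c, d\<close> an induced square if the four sides are labelled \<open>2\<close> and the two
  diagonals \<open>\<infinity>\<close>. In the Coxeter group, \<open>a\<close> and \<open>c\<close> then commute with \<open>b\<close> and \<open>d\<close>, whereas \<open>a c\<close> and
  \<open>b d\<close> have infinite order, so that \<open>a c\<close> and \<open>b d\<close> generate a free abelian group of rank two. A
  hyperbolic group does not contain such a subgroup. It remains to see that a random graph contains
  an induced square asymptotically almost surely.

  \<^emph>\<open>Hyperbolic groups.\<close> The obstruction is growth (\<open>centralizer_linear_growth\<close>). Let \<open>x\<close> be a very
  long element and \<open>y\<close> the midpoint of a geodesic from \<open>1\<close> to \<open>x\<close>. If \<open>z\<close> commutes with \<open>x\<close>, then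
  this geodesic and its translate by \<open>z\<close> are opposite sides of a quadrilateral
  \<open>1, x, z x = x z, z\<close> whose other two sides have length \<open>|z|\<close>. Far from these short sides the
  quadrilateral is thin, so \<open>z y\<close> lies at bounded distance from a vertex of the geodesic whose
  distance to \<open>y\<close> is at most about \<open>|z|\<close>. As \<open>z y\<close> determines \<open>z\<close>, only linearly many (in \<open>\<rho>\<close>) elements of
  length at most \<open>\<rho>\<close> commute with \<open>x\<close>. In a free abelian group of rank two there are
  quadratically many (\<open>not_hyperbolic_if_rank_two_abelian\<close>).

  \<^emph>\<open>Coxeter groups.\<close> That the powers of \<open>a c\<close> and \<open>b d\<close> are independent is seen in the geometric
  representation, in which the generators act as reflections for the form with entries
  \<open>- cos (\<pi> / m)\<close>. The relation \<open>(v w)\<^sup>m = 1\<close> holds because \<open>v w\<close> acts on the plane of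
  \<open>v\<close> and \<open>w\<close> as a rotation by \<open>2 \<pi> / m\<close> (\<open>reflections_rotate\<close>). For \<open>m = \<infinity>\<close> the rotation becomes a
  shear of infinite order (\<open>infinite_dihedral_orbit\<close>).

  \<^emph>\<open>Random graphs.\<close> Induced squares are counted by the second moment method. Write \<open>x\<close> for the
  probability of the label \<open>2\<close> and \<open>y\<close> for that of \<open>\<infinity>\<close>. Among \<open>m\<^sup>4\<close> candidate quadruples, those
  sharing a set \<open>S\<close> of at least two vertices contribute to the relative variance at most
  \<open>1 / (m ^ |S| W S)\<close>, where \<open>W S\<close> is the probability of the labels required on the pairs in \<open>S\<close>.
  Each of these denominators is at least \<open>m\<^sup>2 x\<^sup>2 y\<close> (\<open>square_weight_bound\<close>), which for \<open>m\<close>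
  proportional to \<open>n\<close> is, up to a constant, the square root of \<open>n\<^sup>4 x\<^sup>4 y\<^sup>2\<close> and tends to infinity.
\<close>
section \<open>Geodesic triangles and quadrilaterals with vertices in a graph\<close>

lemma delta_hyperbolicD:
  assumes "delta_hyperbolic M d \<delta>" "geodesic_segment M d x y A" "geodesic_segment M d y z B"
    "geodesic_segment M d x z C" "c \<in> C"
  shows "\<exists>q\<in>A \<union> B. d c q \<le> \<delta>"
  using assms unfolding delta_hyperbolic_def by blast

locale connected_graph =
  fixes V :: "'a set" and E :: "'a rel"
  assumes E: "E \<subseteq> V \<times> V" "sym E" "irrefl E"
    and connected: "\<And>x y. x \<in> V \<Longrightarrow> y \<in> V \<Longrightarrow> (x, y) \<in> E\<^sup>*"
begin

abbreviation vertex :: "'a \<Rightarrow> 'a \<Rightarrow> real" where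
  "vertex x \<equiv> edge_point x x 0"

lemma dist_walk: "x \<in> V \<Longrightarrow> y \<in> V \<Longrightarrow> (x, y) \<in> E ^^ graph_dist E x y"
  by (rule graph_dist_walk[OF E]) (rule connected)

lemma dist_sym: "graph_dist E x y = graph_dist E y x"
  by (rule graph_dist_sym[OF E]) (rule connected)

lemma dist_triangle:
  "x \<in> V \<Longrightarrow> y \<in> V \<Longrightarrow> z \<in> V \<Longrightarrow> graph_dist E x z \<le> graph_dist E x y + graph_dist E y z"
  by (rule graph_dist_triangle[OF E]) (rule connected)

lemma dist_vertices:
  "x \<in> V \<Longrightarrow> y \<in> V \<Longrightarrow> realization_dist E (vertex x) (vertex y) = real (graph_dist E x y)"
  by (rule realization_dist_vertices[OF E]) (rule connected)

lemma real_dist_le: "r \<in> path_lengths E f g \<Longrightarrow> realization_dist E f g \<le> r"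
  by (rule realization_dist_le[OF E]) (auto intro: connected)

lemma metric: "Metric_space (realization V E)
    (\<lambda>f g. if f \<in> realization V E \<and> g \<in> realization V E then realization_dist E f g else 0)"
  by (rule Metric_space_realization[OF E]) (rule connected)

lemma real_dist_triangle:
  assumes "f \<in> realization V E" "g \<in> realization V E" "h \<in> realization V E"
  shows "realization_dist E f h \<le> realization_dist E f g + realization_dist E g h"
  using Metric_space.triangle[OF metric, of f g h] assms by simp

lemma real_dist_sym:
  assumes "f \<in> realization V E" "g \<in> realization V E"
  shows "realization_dist E f g = realization_dist E g f"
  using Metric_space.commute[OF metric, of f g] assms by simp

lemma vertex_in_realization: "x \<in> V \<Longrightarrow> vertex x \<in> realization V E"
  unfolding realization_def by fastforce

text \<open>
  Hyperbolicity speaks about all points of the realization. The lemmas up to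
  \<open>thin_quadrilateral_walks\<close> translate it into a statement about vertices and \<open>graph_dist\<close>: a
  geodesic sequence of vertices traces out a geodesic segment, whose points are all within distance
  \<open>1\<close> of one of the vertices.
\<close>
definition geodesic_walk :: "(nat \<Rightarrow> 'a) \<Rightarrow> nat \<Rightarrow> bool" where
  "geodesic_walk p L \<longleftrightarrow> p ` {..L} \<subseteq> V \<and> (\<forall>i j. i \<le> j \<and> j \<le> L \<longrightarrow> graph_dist E (p i) (p j) = j - i)"

lemma geodesic_walk_vertex: "geodesic_walk p L \<Longrightarrow> i \<le> L \<Longrightarrow> p i \<in> V"
  by (auto simp: geodesic_walk_def)

lemma geodesic_walk_dist:
  "geodesic_walk p L \<Longrightarrow> i \<le> j \<Longrightarrow> j \<le> L \<Longrightarrow> graph_dist E (p i) (p j) = j - i"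
  by (auto simp: geodesic_walk_def)

lemma relpow_along:
  assumes "\<And>i. i < n \<Longrightarrow> (p i, p (Suc i)) \<in> E" "i + k \<le> n"
  shows "(p i, p (i + k)) \<in> E ^^ k"
  using assms(2)
proof (induction k)
  case (Suc k)
  then show ?case using assms(1)[of "i + k"] by auto
qed auto

lemma geodesic_walk_exists:
  assumes x: "x \<in> V" and y: "y \<in> V"
  obtains p where "geodesic_walk p (graph_dist E x y)" "p 0 = x" "p (graph_dist E x y) = y"
proof -
  let ?L = "graph_dist E x y"
  obtain p where p: "p 0 = x" "p ?L = y" "\<And>i. i < ?L \<Longrightarrow> (p i, p (Suc i)) \<in> E"
    using dist_walk[OF x y] unfolding relpow_fun_conv by blast
  have V: "p i \<in> V" if "i \<le> ?L" for i
  proof (cases i)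
    case 0
    then show ?thesis using p x by simp
  next
    case (Suc k)
    then show ?thesis using p(3)[of k] E(1) that by auto
  qed
  have le: "graph_dist E (p i) (p j) \<le> j - i" if "i \<le> j" "j \<le> ?L" for i j
    using relpow_along[of ?L p i "j - i"] p(3) that by (intro graph_dist_le) auto
  have "graph_dist E (p i) (p j) = j - i" if ij: "i \<le> j" "j \<le> ?L" for i j
  proof -
    have "?L \<le> graph_dist E x (p i) + graph_dist E (p i) y"
      "graph_dist E (p i) y \<le> graph_dist E (p i) (p j) + graph_dist E (p j) y"
      using x y V ij by (auto intro!: dist_triangle)
    moreover have "graph_dist E x (p i) \<le> i" using le[of 0 i] p ij by simp
    moreover have "graph_dist E (p j) y \<le> ?L - j" using le[of j ?L] p ij by simp
    ultimately show ?thesis using le[OF ij] ij by linarith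
  qed
  then have "geodesic_walk p ?L" unfolding geodesic_walk_def using V by auto
  then show ?thesis using that p by blast
qed

lemma geodesic_walk_edge:
  assumes p: "geodesic_walk p L" and i: "Suc i \<le> L"
  shows "(p i, p (Suc i)) \<in> E"
proof -
  have "graph_dist E (p i) (p (Suc i)) = 1" using geodesic_walk_dist[OF p, of i "Suc i"] i by simp
  then show ?thesis using dist_walk[of "p i" "p (Suc i)"] geodesic_walk_vertex[OF p] i by simp
qed

definition walk_point :: "(nat \<Rightarrow> 'a) \<Rightarrow> real \<Rightarrow> 'a \<Rightarrow> real" where
  "walk_point p t = edge_point (p (nat \<lfloor>t\<rfloor>)) (p (Suc (nat \<lfloor>t\<rfloor>))) (frac t)"

lemma walk_point_nat: "walk_point p (real k) = vertex (p k)"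
  by (simp add: walk_point_def frac_def) (rule edge_point_0)

lemma walk_point_cases:
  assumes "0 \<le> t" "t \<le> real L"
  obtains k where "k \<le> L" "t = real k" | k where "k < L" "real k < t" "t < real k + 1"
proof -
  have k: "real (nat \<lfloor>t\<rfloor>) \<le> t" "t < real (nat \<lfloor>t\<rfloor>) + 1" using assms by linarith+
  show ?thesis
  proof (cases "t = real (nat \<lfloor>t\<rfloor>)")
    case True
    then have "nat \<lfloor>t\<rfloor> \<le> L" using assms by linarith
    with True show ?thesis using that by blast
  next
    case False
    then have "nat \<lfloor>t\<rfloor> < L" "real (nat \<lfloor>t\<rfloor>) < t" using assms k by linarith+
    with k show ?thesis using that by blast
  qed
qed

lemma walk_point_between:
  assumes "real k \<le> t" "t < real k + 1"
  shows "walk_point p t = edge_point (p k) (p (Suc k)) (t - real k)"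
proof -
  have "\<lfloor>t\<rfloor> = int k" using assms by linarith
  then show ?thesis by (simp add: walk_point_def frac_def)
qed

lemma walk_point_in_realization:
  assumes p: "geodesic_walk p L" and t: "0 \<le> t" "t \<le> real L"
  shows "walk_point p t \<in> realization V E"
  using t
proof (cases rule: walk_point_cases)
  case (1 k)
  then show ?thesis using vertex_in_realization geodesic_walk_vertex[OF p] by (simp add: walk_point_nat)
next
  case (2 k)
  then have "(p k, p (Suc k)) \<in> E" using geodesic_walk_edge[OF p] by simp
  moreover have "t - real k \<in> {0..1}" using 2 by simp
  moreover have "walk_point p t = edge_point (p k) (p (Suc k)) (t - real k)"
    using 2 by (intro walk_point_between) auto
  ultimately show ?thesis using E(1) unfolding realization_def by blast
qed

lemma walk_point_near:
  assumes p: "geodesic_walk p L" and k: "k \<le> L" and t: "real k \<le> t" "t < real k + 1" "t \<le> real L"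
    and s: "real k \<le> s" "s \<le> t"
  shows "realization_dist E (walk_point p s) (walk_point p t) \<le> t - s"
proof (cases "t = real k")
  case True
  then show ?thesis using s dist_vertices[of "p k" "p k"] geodesic_walk_vertex[OF p k] by (simp add: walk_point_nat)
next
  case False
  then have "Suc k \<le> L" using t by linarith
  then have "(p k, p (Suc k)) \<in> E\<^sup>=" using geodesic_walk_edge[OF p] by simp
  moreover have "walk_point p s = edge_point (p k) (p (Suc k)) (s - real k)"
    "walk_point p t = edge_point (p k) (p (Suc k)) (t - real k)"
    using t s by (auto intro!: walk_point_between)
  ultimately have "\<bar>(s - real k) - (t - real k)\<bar> \<in> path_lengths E (walk_point p s) (walk_point p t)"
    using t s by (intro path_lengths_sameI) auto
  from real_dist_le[OF this] show ?thesis using s by simp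
qed

lemma walk_point_next_vertex:
  assumes p: "geodesic_walk p L" and k: "Suc k \<le> L" and s: "real k \<le> s" "s < real (Suc k)"
  shows "realization_dist E (walk_point p s) (vertex (p (Suc k))) \<le> real (Suc k) - s"
proof -
  have "(p k, p (Suc k)) \<in> E\<^sup>=" using geodesic_walk_edge[OF p] k by simp
  moreover have "walk_point p s = edge_point (p k) (p (Suc k)) (s - real k)"
    using s by (auto intro!: walk_point_between)
  moreover have "vertex (p (Suc k)) = edge_point (p k) (p (Suc k)) 1"
    by (auto simp: edge_point_def)
  ultimately have "\<bar>(s - real k) - 1\<bar> \<in> path_lengths E (walk_point p s) (vertex (p (Suc k)))"
    using s by (intro path_lengths_sameI) auto
  from real_dist_le[OF this] show ?thesis using s by simp
qed

text \<open>
  For points in different edges, go to the next vertex after \<open>s\<close>, then to the last vertex before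
  \<open>t\<close>, then to \<open>t\<close>; the lengths of the three pieces add up to \<open>t - s\<close>.
\<close>
lemma walk_point_lipschitz:
  assumes p: "geodesic_walk p L" and st: "0 \<le> s" "s \<le> t" "t \<le> real L"
  shows "realization_dist E (walk_point p s) (walk_point p t) \<le> t - s"
proof -
  let ?D = "realization_dist E" and ?w = "walk_point p"
  define k l where "k = nat \<lfloor>s\<rfloor>" and "l = nat \<lfloor>t\<rfloor>"
  have k: "real k \<le> s" "s < real k + 1" and l: "real l \<le> t" "t < real l + 1" and "k \<le> l" "l \<le> L"
    using st unfolding k_def l_def by linarith+
  show ?thesis
  proof (cases "k = l")
    case True
    then show ?thesis using walk_point_near[OF p \<open>l \<le> L\<close>] k l st by simp
  next
    case False
    then have kl: "Suc k \<le> l" using \<open>k \<le> l\<close> by simp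
    have V: "p (Suc k) \<in> V" "p l \<in> V" using geodesic_walk_vertex[OF p] kl \<open>l \<le> L\<close> by auto
    have M: "?w s \<in> realization V E" "?w t \<in> realization V E"
      "vertex (p (Suc k)) \<in> realization V E" "vertex (p l) \<in> realization V E"
      using walk_point_in_realization[OF p] vertex_in_realization V st by auto
    have "?D (?w s) (vertex (p (Suc k))) \<le> real (Suc k) - s"
      using k kl \<open>l \<le> L\<close> by (intro walk_point_next_vertex[OF p]) auto
    moreover have "?D (vertex (p (Suc k))) (vertex (p l)) = real (l - Suc k)"
      using dist_vertices[OF V] geodesic_walk_dist[OF p kl \<open>l \<le> L\<close>] by simp
    moreover have "?D (vertex (p l)) (?w t) \<le> t - real l"
      using walk_point_near[OF p \<open>l \<le> L\<close> l st(3), of "real l"] l by (simp add: walk_point_nat)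
    moreover have "?D (?w s) (?w t) \<le> ?D (?w s) (vertex (p (Suc k))) + ?D (vertex (p (Suc k))) (?w t)"
      "?D (vertex (p (Suc k))) (?w t) \<le> ?D (vertex (p (Suc k))) (vertex (p l)) + ?D (vertex (p l)) (?w t)"
      using M by (auto intro: real_dist_triangle)
    ultimately show ?thesis using kl by (simp add: of_nat_diff)
  qed
qed

text \<open>
  The lower bound comes from the end points: they are \<open>L\<close> apart, so by the triangle inequality no
  piece in between can be shorter than the Lipschitz bound allows.
\<close>
lemma walk_point_isometry:
  assumes p: "geodesic_walk p L" and st: "0 \<le> s" "s \<le> t" "t \<le> real L"
  shows "realization_dist E (walk_point p s) (walk_point p t) = t - s"
proof (rule antisym)
  let ?D = "realization_dist E" and ?w = "walk_point p"
  have M: "?w r \<in> realization V E" if "0 \<le> r" "r \<le> real L" for r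
    using walk_point_in_realization[OF p that] .
  have "?D (?w 0) (?w (real L)) = real L"
    using dist_vertices[of "p 0" "p L"] geodesic_walk_dist[OF p, of 0 L] geodesic_walk_vertex[OF p]
      walk_point_nat[of p 0] walk_point_nat[of p L] by simp
  moreover have "?D (?w 0) (?w s) \<le> s" "?D (?w t) (?w (real L)) \<le> real L - t"
    using walk_point_lipschitz[OF p, of 0 s] walk_point_lipschitz[OF p, of t "real L"] st by auto
  moreover have "?D (?w 0) (?w (real L)) \<le> ?D (?w 0) (?w s) + ?D (?w s) (?w (real L))"
    "?D (?w s) (?w (real L)) \<le> ?D (?w s) (?w t) + ?D (?w t) (?w (real L))"
    using M st by (auto intro!: real_dist_triangle)
  ultimately show "t - s \<le> ?D (?w s) (?w t)" by linarith
qed (rule walk_point_lipschitz[OF assms])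

lemma walk_point_dist:
  assumes p: "geodesic_walk p L" and "s \<in> {0..real L}" "t \<in> {0..real L}"
  shows "realization_dist E (walk_point p s) (walk_point p t) = \<bar>s - t\<bar>"
  using walk_point_isometry[OF p, of s t] walk_point_isometry[OF p, of t s] assms
    real_dist_sym[OF walk_point_in_realization[OF p] walk_point_in_realization[OF p], of s t]
  by (cases "s \<le> t") auto

lemma geodesic_segment_walk:
  assumes p: "geodesic_walk p L"
  shows "geodesic_segment (realization V E) (realization_dist E) (vertex (p 0)) (vertex (p L))
    (walk_point p ` {0..real L})"
  unfolding geodesic_segment_def
proof (intro exI conjI ballI)
  show "walk_point p ` {0..real L} \<subseteq> realization V E" using walk_point_in_realization[OF p] by auto
  show "walk_point p 0 = vertex (p 0)" "walk_point p (real L) = vertex (p L)"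
    using walk_point_nat[of p 0] walk_point_nat[of p L] by simp_all
qed (use walk_point_dist[OF p] in simp_all)

lemma walk_point_near_vertex:
  assumes p: "geodesic_walk p L" and t: "t \<in> {0..real L}"
  shows "\<exists>k\<le>L. realization_dist E (walk_point p t) (vertex (p k)) \<le> 1"
proof -
  define k where "k = nat \<lfloor>t\<rfloor>"
  have "0 \<le> t" "t \<le> real L" using t by simp_all
  then have k: "k \<le> L" "real k \<le> t" "t < real k + 1" unfolding k_def by linarith+
  then have "realization_dist E (walk_point p t) (walk_point p (real k)) \<le> 1"
    using walk_point_dist[OF p t, of "real k"] by simp
  then show ?thesis using k(1) unfolding walk_point_nat by blast
qed

text \<open>
  The additional \<open>1\<close> pays for moving from a point of a side to a nearby vertex of it.
\<close>
lemma slim_triangle_walks: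
  assumes hyp: "delta_hyperbolic (realization V E) (realization_dist E) \<delta>"
    and p: "geodesic_walk p L" and q: "geodesic_walk q M" and r: "geodesic_walk r N"
    and ends: "p 0 = q 0" "q M = r 0" "r N = p L" and k: "k \<le> L"
  shows "(\<exists>j\<le>M. real (graph_dist E (p k) (q j)) \<le> \<delta> + 1) \<or>
    (\<exists>j\<le>N. real (graph_dist E (p k) (r j)) \<le> \<delta> + 1)"
proof -
  let ?D = "realization_dist E"
  let ?Q = "walk_point q ` {0..real M}" and ?R = "walk_point r ` {0..real N}"
  have "vertex (p k) \<in> walk_point p ` {0..real L}"
    using walk_point_nat[of p k] k by (intro image_eqI[of _ _ "real k"]) auto
  then obtain x where x: "x \<in> ?Q \<union> ?R" "?D (vertex (p k)) x \<le> \<delta>"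
    using delta_hyperbolicD[OF hyp geodesic_segment_walk[OF q, folded ends(1)]
        geodesic_segment_walk[OF r, folded ends(2), unfolded ends(3)] geodesic_segment_walk[OF p]] by blast
  have near: "real (graph_dist E (p k) v) \<le> \<delta> + 1"
    if "x \<in> realization V E" "v \<in> V" "?D x (vertex v) \<le> 1" for v
  proof -
    have "p k \<in> V" using geodesic_walk_vertex[OF p k] .
    then have "?D (vertex (p k)) (vertex v) \<le> ?D (vertex (p k)) x + ?D x (vertex v)"
      using that vertex_in_realization by (intro real_dist_triangle) auto
    then show ?thesis using dist_vertices[OF \<open>p k \<in> V\<close> that(2)] that x by linarith
  qed
  from x(1) show ?thesis
  proof
    assume "x \<in> ?Q"
    then obtain t where t: "t \<in> {0..real M}" "x = walk_point q t" by blast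
    then obtain j where "j \<le> M" "?D x (vertex (q j)) \<le> 1"
      using walk_point_near_vertex[OF q] by blast
    moreover have "x \<in> realization V E" using walk_point_in_realization[OF q] t by simp
    ultimately show ?thesis using near[of "q j"] geodesic_walk_vertex[OF q] by blast
  next
    assume "x \<in> ?R"
    then obtain t where t: "t \<in> {0..real N}" "x = walk_point r t" by blast
    then obtain j where "j \<le> N" "?D x (vertex (r j)) \<le> 1"
      using walk_point_near_vertex[OF r] by blast
    moreover have "x \<in> realization V E" using walk_point_in_realization[OF r] t by simp
    ultimately show ?thesis using near[of "r j"] geodesic_walk_vertex[OF r] by blast
  qed
qed

text \<open>
  The quadrilateral is cut along a diagonal from \<open>q 0\<close> to \<open>p L\<close> into two slim triangles. A vertex
  \<open>p k\<close> that is too far from both ends to be near a short side is near the diagonal, and from there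
  near the side \<open>q\<close>.
\<close>
lemma thin_quadrilateral_walks:
  assumes hyp: "delta_hyperbolic (realization V E) (realization_dist E) \<delta>"
    and p: "geodesic_walk p L" and q: "geodesic_walk q M"
    and \<rho>: "graph_dist E (p 0) (q 0) \<le> \<rho>" "graph_dist E (q M) (p L) \<le> \<rho>" 
    and k: "k \<le> L" "real \<rho> + 2 * (\<delta> + 1) < real k" "real \<rho> + 2 * (\<delta> + 1) < real (L - k)"
    and \<delta>: "0 \<le> \<delta>"
  shows "\<exists>j\<le>M. real (graph_dist E (p k) (q j)) \<le> 2 * (\<delta> + 1)"
proof -
  let ?d = "graph_dist E"
  have V: "p 0 \<in> V" "q 0 \<in> V" "p L \<in> V" "q M \<in> V" "p k \<in> V"
    using geodesic_walk_vertex[OF p] geodesic_walk_vertex[OF q] k by auto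
  obtain a where a: "geodesic_walk a (?d (p 0) (q 0))" "a 0 = p 0" "a (?d (p 0) (q 0)) = q 0"
    using geodesic_walk_exists V by blast
  obtain b where b: "geodesic_walk b (?d (q 0) (p L))" "b 0 = q 0" "b (?d (q 0) (p L)) = p L"
    using geodesic_walk_exists V by blast
  obtain c where c: "geodesic_walk c (?d (q M) (p L))" "c 0 = q M" "c (?d (q M) (p L)) = p L"
    using geodesic_walk_exists V by blast
  \<comment> \<open>\<open>a\<close> and \<open>c\<close> are the short sides, \<open>b\<close> is the diagonal.\<close>
  have "\<not> (\<exists>j\<le>?d (p 0) (q 0). real (?d (p k) (a j)) \<le> \<delta> + 1)"
  proof
    assume "\<exists>j\<le>?d (p 0) (q 0). real (?d (p k) (a j)) \<le> \<delta> + 1"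
    then obtain j where j: "j \<le> ?d (p 0) (q 0)" "real (?d (p k) (a j)) \<le> \<delta> + 1" by blast
    have "a j \<in> V" "?d (p 0) (a j) = j"
      using geodesic_walk_vertex[OF a(1)] geodesic_walk_dist[OF a(1), of 0 j] j a by auto
    moreover have "?d (p 0) (p k) = k" using geodesic_walk_dist[OF p, of 0 k] k by simp
    moreover have "?d (p 0) (p k) \<le> ?d (p 0) (a j) + ?d (a j) (p k)"
      using V \<open>a j \<in> V\<close> by (intro dist_triangle)
    ultimately have "k \<le> \<rho> + ?d (p k) (a j)" using j(1) \<rho>(1) dist_sym[of "a j" "p k"] by linarith
    then have "real k \<le> real \<rho> + real (?d (p k) (a j))" by linarith
    then show False using j(2) k(2) \<delta> by simp
  qed
  then obtain j where j: "j \<le> ?d (q 0) (p L)" "real (?d (p k) (b j)) \<le> \<delta> + 1"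
    using slim_triangle_walks[OF hyp p a(1) b(1) _ _ _ k(1)] a b by auto
  have "b j \<in> V" using geodesic_walk_vertex[OF b(1) j(1)] .
  consider i where "i \<le> M" "real (?d (b j) (q i)) \<le> \<delta> + 1"
    | i where "i \<le> ?d (q M) (p L)" "real (?d (b j) (c i)) \<le> \<delta> + 1"
    using slim_triangle_walks[OF hyp b(1) q c(1) _ _ _ j(1)] b c by auto
  then show ?thesis
  proof cases
    case 1
    have "?d (p k) (q i) \<le> ?d (p k) (b j) + ?d (b j) (q i)"
      using V \<open>b j \<in> V\<close> geodesic_walk_vertex[OF q] 1 by (intro dist_triangle)
    then have "real (?d (p k) (q i)) \<le> real (?d (p k) (b j)) + real (?d (b j) (q i))" by linarith
    then show ?thesis using 1 j(2) by (intro exI[of _ i]) simp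
  next
    case 2
    have "c i \<in> V" "?d (c i) (p L) = ?d (q M) (p L) - i"
      using geodesic_walk_vertex[OF c(1)] geodesic_walk_dist[OF c(1) 2(1)] c 2 by auto
    moreover have "?d (p k) (p L) = L - k" using geodesic_walk_dist[OF p k(1)] by simp
    moreover have "?d (p k) (p L) \<le> ?d (p k) (b j) + ?d (b j) (p L)"
      "?d (b j) (p L) \<le> ?d (b j) (c i) + ?d (c i) (p L)"
      using V \<open>b j \<in> V\<close> \<open>c i \<in> V\<close> by (auto intro: dist_triangle)
    ultimately have "L - k \<le> ?d (p k) (b j) + ?d (b j) (c i) + \<rho>" using \<rho>(2) by linarith
    then have "real (L - k) \<le> real (?d (p k) (b j)) + real (?d (b j) (c i)) + real \<rho>" by linarith
    then show ?thesis using 2(2) j(2) k(3) by simp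
  qed
qed

end

section \<open>Commuting elements of hyperbolic groups\<close>

context group
begin

lemma connected_cayley_graph:
  assumes S: "S \<subseteq> carrier G" "generate G S = carrier G"
  shows "connected_graph (carrier G) (cayley_edges G S)"
proof
  let ?E = "cayley_edges G S"
  show "?E \<subseteq> carrier G \<times> carrier G" "irrefl ?E" by (auto simp: cayley_edges_def irrefl_def)
  show sym: "sym ?E" by (auto simp: cayley_edges_def sym_def)
  have step: "(x, x \<otimes> s) \<in> ?E\<^sup>*" "(x, x \<otimes> inv s) \<in> ?E\<^sup>*" if "x \<in> carrier G" "s \<in> S" for x s
  proof -
    have s: "s \<in> carrier G" using that S by blast
    have "x = x \<otimes> s \<or> (x, x \<otimes> s) \<in> ?E"
      using that s by (auto simp: cayley_edges_def)
    moreover have "x = x \<otimes> inv s \<or> (x, x \<otimes> inv s) \<in> ?E"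
      using that s by (auto simp: cayley_edges_def m_assoc intro!: bexI[of _ s])
    ultimately show "(x, x \<otimes> s) \<in> ?E\<^sup>*" "(x, x \<otimes> inv s) \<in> ?E\<^sup>*" by auto
  qed
  have gen: "\<forall>x\<in>carrier G. (x, x \<otimes> y) \<in> ?E\<^sup>*" if "y \<in> generate G S" for y
    using that
  proof induction
    case (eng h1 h2)
    have c: "h1 \<in> carrier G" "h2 \<in> carrier G" using eng generate_in_carrier[OF S(1)] by auto
    show ?case
    proof
      fix x assume x: "x \<in> carrier G"
      have "(x, x \<otimes> h1) \<in> ?E\<^sup>*" "(x \<otimes> h1, x \<otimes> h1 \<otimes> h2) \<in> ?E\<^sup>*" using eng.IH c x by auto
      then show "(x, x \<otimes> (h1 \<otimes> h2)) \<in> ?E\<^sup>*" using c x by (simp add: m_assoc)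
    qed
  qed (use step in auto)
  show "(x, y) \<in> ?E\<^sup>*" if "x \<in> carrier G" "y \<in> carrier G" for x y
  proof -
    have "inv x \<otimes> y \<in> generate G S" using that S by simp
    then have "(x, x \<otimes> (inv x \<otimes> y)) \<in> ?E\<^sup>*" using gen that by blast
    then show ?thesis using that by (simp add: m_assoc[symmetric])
  qed
qed

lemma cayley_edges_translate:
  assumes "g \<in> carrier G" "S \<subseteq> carrier G" "(x, y) \<in> cayley_edges G S"
  shows "(g \<otimes> x, g \<otimes> y) \<in> cayley_edges G S"
  using assms by (fastforce simp: cayley_edges_def m_assoc subset_iff)

lemma cayley_relpow_translate:
  assumes "g \<in> carrier G" "S \<subseteq> carrier G" "(x, y) \<in> cayley_edges G S ^^ n"
  shows "(g \<otimes> x, g \<otimes> y) \<in> cayley_edges G S ^^ n"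
  using assms(3)
proof (induction n arbitrary: y)
  case (Suc n)
  then obtain z where "(x, z) \<in> cayley_edges G S ^^ n" "(z, y) \<in> cayley_edges G S" by auto
  then show ?case using Suc.IH cayley_edges_translate[OF assms(1,2)] by auto
qed auto

lemma cayley_dist_translate:
  assumes "g \<in> carrier G" "S \<subseteq> carrier G" "x \<in> carrier G" "y \<in> carrier G"
  shows "graph_dist (cayley_edges G S) (g \<otimes> x) (g \<otimes> y) = graph_dist (cayley_edges G S) x y"
proof -
  have "(g \<otimes> x, g \<otimes> y) \<in> cayley_edges G S ^^ n \<longleftrightarrow> (x, y) \<in> cayley_edges G S ^^ n" for n
    using cayley_relpow_translate[OF assms(1,2)]
      cayley_relpow_translate[of "inv g" S "g \<otimes> x" "g \<otimes> y"] assms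
    by (auto simp: m_assoc[symmetric])
  then show ?thesis unfolding graph_dist_def by simp
qed

lemma finite_cayley_relpow:
  assumes "finite S" "S \<subseteq> carrier G"
  shows "finite {y. (x, y) \<in> cayley_edges G S ^^ n}"
proof (induction n)
  case (Suc n)
  have "finite {y. (z, y) \<in> cayley_edges G S}" for z
  proof (rule finite_subset)
    show "{y. (z, y) \<in> cayley_edges G S} \<subseteq> (\<lambda>s. z \<otimes> s) ` S \<union> (\<lambda>s. z \<otimes> inv s) ` S"
    proof
      fix y assume "y \<in> {y. (z, y) \<in> cayley_edges G S}"
      then obtain s where s: "y \<in> carrier G" "s \<in> S" "y = z \<otimes> s \<or> z = y \<otimes> s"
        by (auto simp: cayley_edges_def)
      then have "y = z \<otimes> s \<or> y = z \<otimes> inv s" using assms(2) by (auto simp: m_assoc subset_iff)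
      then show "y \<in> (\<lambda>s. z \<otimes> s) ` S \<union> (\<lambda>s. z \<otimes> inv s) ` S" using s by auto
    qed
  qed (use assms in auto)
  then have "finite (\<Union>z\<in>{z. (x, z) \<in> cayley_edges G S ^^ n}. {y. (z, y) \<in> cayley_edges G S})"
    using Suc.IH by blast
  moreover have "{y. (x, y) \<in> cayley_edges G S ^^ Suc n} =
      (\<Union>z\<in>{z. (x, z) \<in> cayley_edges G S ^^ n}. {y. (z, y) \<in> cayley_edges G S})"
    by auto
  ultimately show ?case by simp
qed auto

lemma finite_cayley_ball:
  assumes S: "finite S" "S \<subseteq> carrier G" "generate G S = carrier G"
  shows "finite {x \<in> carrier G. graph_dist (cayley_edges G S) \<one> x \<le> n}"
proof (rule finite_subset)
  interpret connected_graph "carrier G" "cayley_edges G S" using connected_cayley_graph S by blast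
  show "{x \<in> carrier G. graph_dist (cayley_edges G S) \<one> x \<le> n} \<subseteq>
      (\<Union>k\<le>n. {y. (\<one>, y) \<in> cayley_edges G S ^^ k})"
    using dist_walk[OF one_closed] by blast
  show "finite (\<Union>k\<le>n. {y. (\<one>, y) \<in> cayley_edges G S ^^ k})"
    using finite_cayley_relpow[OF S(1,2)] by blast
qed

text \<open>
  An element \<open>z\<close> that commutes with \<open>x\<close> moves the midpoint \<open>q k\<close> of a geodesic from \<open>1\<close> to \<open>x\<close> into
  the \<open>c\<close>-neighbourhood of some \<open>q j\<close> with \<open>j\<close> at most \<open>\<rho> + c\<close> away from \<open>k\<close>. So
  \<open>z = q j \<otimes> w \<otimes> inv (q k)\<close> with \<open>w\<close> in the ball of radius \<open>c\<close>, and such pairs \<open>(j, w)\<close> are what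
  the right-hand side counts. The length of \<open>x\<close> keeps the midpoint away from the short sides of the
  quadrilateral.
\<close>
lemma centralizer_linear_growth:
  assumes S: "finite S" "S \<subseteq> carrier G" "generate G S = carrier G"
    and hyp: "delta_hyperbolic (realization (carrier G) (cayley_edges G S))
      (realization_dist (cayley_edges G S)) \<delta>" and \<delta>: "0 \<le> \<delta>"
    and c: "2 * (\<delta> + 1) \<le> real c"
    and x: "x \<in> carrier G" "2 * (\<rho> + c + 1) < graph_dist (cayley_edges G S) \<one> x"
    and Z: "Z \<subseteq> carrier G" "\<And>z. z \<in> Z \<Longrightarrow> z \<otimes> x = x \<otimes> z"
      "\<And>z. z \<in> Z \<Longrightarrow> graph_dist (cayley_edges G S) \<one> z \<le> \<rho>"
  shows "card Z \<le> (2 * (\<rho> + c) + 1) * card {w \<in> carrier G. graph_dist (cayley_edges G S) \<one> w \<le> c}"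
proof -
  let ?d = "graph_dist (cayley_edges G S)" and ?B = "{w \<in> carrier G. graph_dist (cayley_edges G S) \<one> w \<le> c}"
  interpret connected_graph "carrier G" "cayley_edges G S" using connected_cayley_graph S by blast
  define L where "L = ?d \<one> x"
  obtain q where q: "geodesic_walk q L" "q 0 = \<one>" "q L = x"
    using geodesic_walk_exists[OF one_closed x(1)] unfolding L_def by blast
  define k where "k = L div 2"
  have k: "k \<le> L" "\<rho> + c < k" "\<rho> + c < L - k" using x(2) unfolding k_def L_def[symmetric] by auto
  have qV: "q j \<in> carrier G" if "j \<le> L" for j using geodesic_walk_vertex[OF q(1) that] .
  let ?I = "{k - (\<rho> + c)..k + (\<rho> + c)}"
  have "Z \<subseteq> (\<lambda>(j, w). q j \<otimes> w \<otimes> inv (q k)) ` (?I \<times> ?B)"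
  proof
    fix z assume "z \<in> Z"
    then have z: "z \<in> carrier G" "z \<otimes> x = x \<otimes> z" "?d \<one> z \<le> \<rho>" using Z by auto
    define p where "p i = z \<otimes> q i" for i
    have p: "geodesic_walk p L"
      using q(1) z(1) S(2) cayley_dist_translate qV unfolding geodesic_walk_def p_def
      by (auto simp: image_subset_iff)
    have "?d x (x \<otimes> z) \<le> \<rho>" using cayley_dist_translate[OF x(1) S(2) one_closed z(1)] x z by simp
    then have "\<exists>j\<le>L. real (?d (p k) (q j)) \<le> 2 * (\<delta> + 1)"
      using z x q c k \<delta> dist_sym[of z \<one>]
      by (intro thin_quadrilateral_walks[OF hyp p q(1), of \<rho> k]) (auto simp: p_def)
    then obtain j where j: "j \<le> L" "real (?d (p k) (q j)) \<le> 2 * (\<delta> + 1)" by blast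
    then have dc: "?d (p k) (q j) \<le> c" using c by linarith
    have V: "p k \<in> carrier G" "q j \<in> carrier G" "q k \<in> carrier G" using k j qV z by (auto simp: p_def)
    have qd: "?d \<one> (q i) = i" if "i \<le> L" for i using geodesic_walk_dist[OF q(1), of 0 i] q that by simp
    have zk: "?d z (p k) = k" using cayley_dist_translate[OF z(1) S(2) one_closed V(3)] z qd k by (simp add: p_def)
    have "?d \<one> (q j) \<le> ?d \<one> z + ?d z (q j)" "?d z (q j) \<le> ?d z (p k) + ?d (p k) (q j)"
      "?d z (p k) \<le> ?d z \<one> + ?d \<one> (p k)" "?d \<one> (p k) \<le> ?d \<one> (q j) + ?d (q j) (p k)"
      using V z by (auto intro: dist_triangle)
    then have "j \<in> ?I" using qd[OF j(1)] zk dc z(3) dist_sym[of z \<one>] dist_sym[of "q j" "p k"] by auto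
    moreover have "inv (q j) \<otimes> p k \<in> ?B"
      using cayley_dist_translate[of "inv (q j)" S "q j" "p k"] V S dc dist_sym[of "q j" "p k"] by simp
    moreover have "z = q j \<otimes> (inv (q j) \<otimes> p k) \<otimes> inv (q k)"
    proof -
      have "q j \<otimes> (inv (q j) \<otimes> p k) = p k" using V by (simp add: m_assoc[symmetric])
      then show ?thesis using V z by (simp add: p_def m_assoc)
    qed
    ultimately show "z \<in> (\<lambda>(j, w). q j \<otimes> w \<otimes> inv (q k)) ` (?I \<times> ?B)"
      by (intro image_eqI[of _ _ "(j, inv (q j) \<otimes> p k)"]) auto
  qed
  then have "card Z \<le> card ((\<lambda>(j, w). q j \<otimes> w \<otimes> inv (q k)) ` (?I \<times> ?B))"
    using finite_cayley_ball[OF S] by (intro card_mono) auto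
  also have "\<dots> \<le> card (?I \<times> ?B)"
    using finite_cayley_ball[OF S] by (intro card_image_le) auto
  also have "\<dots> = card ?I * card ?B" by (rule card_cartesian_product)
  also have "\<dots> \<le> (2 * (\<rho> + c) + 1) * card ?B" by (intro mult_right_mono) auto
  finally show ?thesis .
qed

lemma cayley_dist_pow:
  assumes S: "S \<subseteq> carrier G" "generate G S = carrier G" and g: "g \<in> carrier G"
  shows "graph_dist (cayley_edges G S) \<one> (g [^] (n::nat)) \<le> n * graph_dist (cayley_edges G S) \<one> g"
proof (induction n)
  case (Suc n)
  interpret connected_graph "carrier G" "cayley_edges G S" using connected_cayley_graph S by blast
  have "graph_dist (cayley_edges G S) \<one> (g [^] n \<otimes> g) \<le> graph_dist (cayley_edges G S) \<one> (g [^] n)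
      + graph_dist (cayley_edges G S) (g [^] n) (g [^] n \<otimes> g)"
    using g by (intro dist_triangle) auto
  also have "graph_dist (cayley_edges G S) (g [^] n) (g [^] n \<otimes> g) = graph_dist (cayley_edges G S) \<one> g"
    using cayley_dist_translate[of "g [^] n" S \<one> g] S g by simp
  finally show ?case using Suc by simp
qed auto

text \<open>
  The \<open>n\<^sup>2\<close> products \<open>g\<^sup>i h\<^sup>j\<close> with \<open>i, j < n\<close> have length at most \<open>n K\<close> and commute with one another,
  in particular with a much longer product \<open>x\<close>, which exists because balls are finite. Linear growth
  of the centralizer of \<open>x\<close> is violated once \<open>n\<close> is large.
\<close>
theorem not_hyperbolic_if_rank_two_abelian:
  assumes g: "g \<in> carrier G" and h: "h \<in> carrier G" and comm: "g \<otimes> h = h \<otimes> g"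
    and inj: "inj (\<lambda>(i::nat, j::nat). g [^] i \<otimes> h [^] j)"
  shows "\<not> hyperbolic_group G"
proof
  assume "hyperbolic_group G"
  then obtain S \<delta> where S: "finite S" "S \<subseteq> carrier G" "generate G S = carrier G"
    and hyp: "delta_hyperbolic (realization (carrier G) (cayley_edges G S))
      (realization_dist (cayley_edges G S)) \<delta>" and \<delta>: "0 \<le> \<delta>"
    unfolding hyperbolic_group_def by blast
  let ?d = "graph_dist (cayley_edges G S)"
  let ?f = "\<lambda>(i::nat, j::nat). g [^] i \<otimes> h [^] j"
  interpret connected_graph "carrier G" "cayley_edges G S" using connected_cayley_graph S by blast
  define c where "c = nat \<lceil>2 * (\<delta> + 1)\<rceil>"
  have c: "2 * (\<delta> + 1) \<le> real c" unfolding c_def by linarith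
  define N where "N = card {w \<in> carrier G. ?d \<one> w \<le> c}"
  define K where "K = ?d \<one> g + ?d \<one> h"
  \<comment> \<open>The linear bound is at most \<open>n * ((2 * K + 2 * c + 1) * N)\<close>, so this is the first \<open>n\<close> with
    \<open>n * n\<close> above it.\<close>
  define n where "n = (2 * K + 2 * c + 1) * N + 1"
  have len: "?d \<one> (?f (i, j)) \<le> n * K" if "i < n" "j < n" for i j
  proof -
    have "?d \<one> (g [^] i \<otimes> h [^] j) \<le> ?d \<one> (g [^] i) + ?d (g [^] i) (g [^] i \<otimes> h [^] j)"
      using g h by (intro dist_triangle) auto
    also have "?d (g [^] i) (g [^] i \<otimes> h [^] j) = ?d \<one> (h [^] j)"
      using cayley_dist_translate[of "g [^] i" S \<one> "h [^] j"] S g h by simp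
    also have "?d \<one> (g [^] i) + ?d \<one> (h [^] j) \<le> i * ?d \<one> g + j * ?d \<one> h"
      using cayley_dist_pow[OF S(2,3) g, of i] cayley_dist_pow[OF S(2,3) h, of j] by linarith
    also have "\<dots> \<le> n * ?d \<one> g + n * ?d \<one> h" using that by (intro add_mono mult_right_mono) auto
    finally show ?thesis by (simp add: K_def algebra_simps)
  qed
  define Z where "Z = ?f ` ({..<n} \<times> {..<n})"
  have "infinite (range ?f)" using finite_imageD[OF _ inj] by (auto simp: finite_prod)
  moreover have "range ?f \<subseteq> carrier G" using g h by auto
  ultimately obtain x where x: "x \<in> range ?f" "2 * (n * K + c + 1) < ?d \<one> x"
    using finite_subset[OF _ finite_cayley_ball[OF S, of "2 * (n * K + c + 1)"]]
    by (smt (verit, ccfv_SIG) mem_Collect_eq not_le subset_eq)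
  have commf: "?f u \<otimes> ?f v = ?f v \<otimes> ?f u" for u v
  proof -
    obtain i j k l where uv: "u = (i, j)" "v = (k, l)" by fastforce
    have gh: "h [^] a \<otimes> g [^] b = g [^] b \<otimes> h [^] a" for a b :: nat
      using group_commutes_pow[OF group_commutes_pow[OF comm g h, symmetric] h nat_pow_closed[OF g]] .
    have "g [^] i \<otimes> h [^] j \<otimes> (g [^] k \<otimes> h [^] l) = g [^] i \<otimes> (h [^] j \<otimes> g [^] k) \<otimes> h [^] l"
      using g h by (simp add: m_assoc)
    also have "\<dots> = g [^] (i + k) \<otimes> h [^] (j + l)"
      unfolding gh using g h by (simp add: m_assoc nat_pow_mult[symmetric])
    also have "\<dots> = g [^] (k + i) \<otimes> h [^] (l + j)" by (simp add: add.commute)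
    also have "\<dots> = g [^] k \<otimes> (h [^] l \<otimes> g [^] i) \<otimes> h [^] j"
      unfolding gh using g h by (simp add: m_assoc nat_pow_mult[symmetric])
    also have "\<dots> = g [^] k \<otimes> h [^] l \<otimes> (g [^] i \<otimes> h [^] j)"
      using g h by (simp add: m_assoc)
    finally show ?thesis unfolding uv by simp
  qed
  have "card Z \<le> (2 * (n * K + c) + 1) * N"
    unfolding N_def
  proof (rule centralizer_linear_growth[OF S hyp \<delta> c _ x(2)])
    show "x \<in> carrier G" using x(1) g h by auto
    show "Z \<subseteq> carrier G" using g h by (auto simp: Z_def)
    show "z \<otimes> x = x \<otimes> z" if "z \<in> Z" for z using that x(1) commf by (auto simp only: Z_def)
    show "?d \<one> z \<le> n * K" if "z \<in> Z" for z using that len by (auto simp: Z_def)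
  qed
  moreover have "card Z = n * n"
    unfolding Z_def using card_image[OF inj_on_subset[OF inj]] by (simp add: card_cartesian_product)
  ultimately have "n * n \<le> (2 * (n * K + c) + 1) * N" by simp
  also have "\<dots> \<le> (2 * (n * K) + 2 * (n * c) + n) * N"
    by (intro mult_right_mono) (auto simp: n_def)
  also have "\<dots> = n * ((2 * K + 2 * c + 1) * N)" by (simp add: algebra_simps)
  finally show False by (simp add: n_def)
qed

end

section \<open>The geometric representation of a Coxeter group\<close>

definition coxeter_form :: "'a labelled_graph \<Rightarrow> 'a \<Rightarrow> 'a \<Rightarrow> real" where
  "coxeter_form \<Gamma> u v =
    (if u = v then 1 else case \<Gamma> {u, v} of enat m \<Rightarrow> - cos (pi / real m) | \<infinity> \<Rightarrow> - 1)"

text \<open>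
  Vectors are families of coordinates indexed by the vertices; \<open>form_with V \<Gamma> x v\<close> is the value of
  the bilinear form on \<open>x\<close> and the basis vector of \<open>v\<close>.
\<close>
definition form_with :: "'a set \<Rightarrow> 'a labelled_graph \<Rightarrow> ('a \<Rightarrow> real) \<Rightarrow> 'a \<Rightarrow> real" where
  "form_with V \<Gamma> x v = (\<Sum>u\<in>V. x u * coxeter_form \<Gamma> u v)"

definition reflection :: "'a set \<Rightarrow> 'a labelled_graph \<Rightarrow> 'a \<Rightarrow> ('a \<Rightarrow> real) \<Rightarrow> 'a \<Rightarrow> real" where
  "reflection V \<Gamma> v x = x(v := x v - 2 * form_with V \<Gamma> x v)"

definition word_action :: "'a set \<Rightarrow> 'a labelled_graph \<Rightarrow> 'a word \<Rightarrow> ('a \<Rightarrow> real) \<Rightarrow> 'a \<Rightarrow> real" where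
  "word_action V \<Gamma> w x = foldr (\<lambda>l. reflection V \<Gamma> (fst l)) w x"

text \<open>
  The vector \<open>x + a e\<^sub>v + b e\<^sub>w\<close>. For \<open>x\<close> orthogonal to \<open>e\<^sub>v\<close> and \<open>e\<^sub>w\<close>, the reflections at \<open>v\<close> and \<open>w\<close> fix
  \<open>x\<close> and change the coefficients \<open>a\<close> and \<open>b\<close> only.
\<close>
definition offset :: "('a \<Rightarrow> real) \<Rightarrow> 'a \<Rightarrow> real \<Rightarrow> 'a \<Rightarrow> real \<Rightarrow> 'a \<Rightarrow> real" where
  "offset x v a w b = (\<lambda>z. x z + a * of_bool (z = v) + b * of_bool (z = w))"

lemma coxeter_form_sym: "coxeter_form \<Gamma> u v = coxeter_form \<Gamma> v u"
  by (simp add: coxeter_form_def insert_commute)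

lemma offset_swap: "offset x v a w b = offset x w b v a"
  by (auto simp: offset_def)

lemma form_with_offset:
  assumes "finite V" "v \<in> V" "w \<in> V"
  shows "form_with V \<Gamma> (offset x v a w b) u =
    form_with V \<Gamma> x u + a * coxeter_form \<Gamma> v u + b * coxeter_form \<Gamma> w u"
proof -
  have "form_with V \<Gamma> (offset x v a w b) u = (\<Sum>z\<in>V. x z * coxeter_form \<Gamma> z u
      + (if z = v then a * coxeter_form \<Gamma> v u else 0) + (if z = w then b * coxeter_form \<Gamma> w u else 0))"
    unfolding form_with_def offset_def by (intro sum.cong) (auto simp: algebra_simps)
  then show ?thesis using assms by (simp add: sum.distrib form_with_def)
qed

lemma reflection_offset:
  assumes "finite V" "v \<in> V" "w \<in> V" "v \<noteq> w" "form_with V \<Gamma> x v = 0"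
  shows "reflection V \<Gamma> v (offset x v a w b) = offset x v (- a - 2 * b * coxeter_form \<Gamma> v w) w b"
  unfolding reflection_def form_with_offset[OF assms(1-3)]
  using assms(4,5) coxeter_form_sym[of \<Gamma> w v]
  by (auto simp: offset_def coxeter_form_def[of \<Gamma> v v] fun_eq_iff algebra_simps)

lemma reflection_involution:
  assumes "finite V" "v \<in> V"
  shows "reflection V \<Gamma> v (reflection V \<Gamma> v x) = x"
proof -
  let ?B = "form_with V \<Gamma> x v"
  have "reflection V \<Gamma> v x = offset x v (- 2 * ?B) v 0"
    by (auto simp: reflection_def offset_def)
  then have "form_with V \<Gamma> (reflection V \<Gamma> v x) v = - ?B"
    using form_with_offset[OF assms(1,2,2), of \<Gamma> x "- 2 * ?B" 0 v] by (simp add: coxeter_form_def)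
  then show ?thesis
    unfolding reflection_def[of V \<Gamma> v "reflection V \<Gamma> v x"] by (simp add: reflection_def)
qed

lemma reflection_fixes: "form_with V \<Gamma> x v = 0 \<Longrightarrow> reflection V \<Gamma> v x = x"
  by (simp add: reflection_def)

lemma two_cos_times_sin: "2 * sin (y::real) * cos \<theta> = sin (y + \<theta>) + sin (y - \<theta>)"
  by (simp add: sin_add sin_diff)

text \<open>
  Put \<open>f \<phi> = sin \<phi> e\<^sub>v + sin (\<phi> + \<theta>) e\<^sub>w\<close>. Since \<open>2 cos \<theta> sin \<psi> = sin (\<psi> + \<theta>) + sin (\<psi> - \<theta>)\<close>,
  the reflection at \<open>v\<close> replaces \<open>sin \<phi>\<close> by \<open>sin (\<phi> + 2 \<theta>)\<close>, and then the one at \<open>w\<close> replaces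
  \<open>sin (\<phi> + \<theta>)\<close> by \<open>sin (\<phi> + 3 \<theta>)\<close>; together they take \<open>f \<phi>\<close> to \<open>f (\<phi> + 2 \<theta>)\<close>. The combination
  of \<open>f \<phi>\<close> and \<open>f (\<phi> - \<theta>)\<close> with coefficients \<open>r\<close> and \<open>s\<close> reaches every vector of the plane, as
  \<open>f 0 = sin \<theta> e\<^sub>w\<close> and \<open>f (- \<theta>) = - sin \<theta> e\<^sub>v\<close>.
\<close>
lemma reflections_rotate:
  fixes r s :: real
  assumes V: "finite V" "v \<in> V" "w \<in> V" "v \<noteq> w"
    and x: "form_with V \<Gamma> x v = 0" "form_with V \<Gamma> x w = 0"
    and \<theta>: "coxeter_form \<Gamma> v w = - cos \<theta>"
  defines "y \<equiv> \<lambda>\<phi>. offset x v (r * sin \<phi> + s * sin (\<phi> - \<theta>)) w (r * sin (\<phi> + \<theta>) + s * sin \<phi>)"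
  shows "((reflection V \<Gamma> w \<circ> reflection V \<Gamma> v) ^^ k) (y 0) = y (real k * (2 * \<theta>))"
proof (induction k)
  case (Suc k)
  define \<phi> where "\<phi> = real k * (2 * \<theta>)"
  have step: "reflection V \<Gamma> w (reflection V \<Gamma> v (y \<phi>)) = y (\<phi> + 2 * \<theta>)"
  proof -
    have "- (r * sin \<phi> + s * sin (\<phi> - \<theta>)) - 2 * (r * sin (\<phi> + \<theta>) + s * sin \<phi>) * coxeter_form \<Gamma> v w
        = - (r * sin \<phi> + s * sin (\<phi> - \<theta>)) + r * (2 * sin (\<phi> + \<theta>) * cos \<theta>) + s * (2 * sin \<phi> * cos \<theta>)"
      by (simp add: \<theta> algebra_simps)
    also have "\<dots> = r * sin (\<phi> + 2 * \<theta>) + s * sin (\<phi> + \<theta>)"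
      unfolding two_cos_times_sin by (simp add: algebra_simps)
    finally have "reflection V \<Gamma> v (y \<phi>) =
        offset x v (r * sin (\<phi> + 2 * \<theta>) + s * sin (\<phi> + \<theta>)) w (r * sin (\<phi> + \<theta>) + s * sin \<phi>)"
      unfolding y_def reflection_offset[OF V x(1)] by simp
    also have "\<dots> =
        offset x w (r * sin (\<phi> + \<theta>) + s * sin \<phi>) v (r * sin (\<phi> + 2 * \<theta>) + s * sin (\<phi> + \<theta>))"
      by (rule offset_swap)
    finally have first: "reflection V \<Gamma> v (y \<phi>) = \<dots>" .
    have "- (r * sin (\<phi> + \<theta>) + s * sin \<phi>)
        - 2 * (r * sin (\<phi> + 2 * \<theta>) + s * sin (\<phi> + \<theta>)) * coxeter_form \<Gamma> w v
      = - (r * sin (\<phi> + \<theta>) + s * sin \<phi>)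
        + r * (2 * sin (\<phi> + 2 * \<theta>) * cos \<theta>) + s * (2 * sin (\<phi> + \<theta>) * cos \<theta>)"
      by (simp add: \<theta> coxeter_form_sym[of \<Gamma> w v] algebra_simps)
    also have "\<dots> = r * sin (\<phi> + 2 * \<theta> + \<theta>) + s * sin (\<phi> + 2 * \<theta>)"
      unfolding two_cos_times_sin by (simp add: algebra_simps)
    finally have second: "- (r * sin (\<phi> + \<theta>) + s * sin \<phi>)
        - 2 * (r * sin (\<phi> + 2 * \<theta>) + s * sin (\<phi> + \<theta>)) * coxeter_form \<Gamma> w v
      = r * sin (\<phi> + 2 * \<theta> + \<theta>) + s * sin (\<phi> + 2 * \<theta>)" .
    have "\<phi> + 2 * \<theta> - \<theta> = \<phi> + \<theta>" by simp
    then show ?thesis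
      unfolding first unfolding reflection_offset[OF V(1,3,2) V(4)[symmetric] x(2)] second unfolding y_def
      by (subst offset_swap) (simp add: add.commute[of \<theta> \<phi>])
  qed
  have "((reflection V \<Gamma> w \<circ> reflection V \<Gamma> v) ^^ Suc k) (y 0) =
      reflection V \<Gamma> w (reflection V \<Gamma> v (y \<phi>))"
    by (simp only: funpow.simps comp_apply Suc.IH \<phi>_def)
  also have "\<dots> = y (real (Suc k) * (2 * \<theta>))"
    unfolding step by (simp add: \<phi>_def algebra_simps)
  finally show ?case .
qed simp

text \<open>
  The form is nondegenerate on the plane of \<open>v\<close> and \<open>w\<close>: its determinant there is \<open>(sin \<theta>)\<^sup>2\<close>. The
  coefficients in the proof solve the resulting linear system.
\<close>
lemma orthogonal_decomposition:
  assumes V: "finite V" "v \<in> V" "w \<in> V" "v \<noteq> w"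
    and \<theta>: "coxeter_form \<Gamma> v w = - cos \<theta>" "sin \<theta> \<noteq> 0"
  obtains x0 a b where "x = offset x0 v a w b" "form_with V \<Gamma> x0 v = 0" "form_with V \<Gamma> x0 w = 0"
proof
  let ?\<xi> = "form_with V \<Gamma> x v" and ?\<eta> = "form_with V \<Gamma> x w"
  let ?a = "(?\<xi> + ?\<eta> * cos \<theta>) / (sin \<theta>)\<^sup>2" and ?b = "(?\<eta> + ?\<xi> * cos \<theta>) / (sin \<theta>)\<^sup>2"
  let ?x0 = "offset x v (- ?a) w (- ?b)"
  show "x = offset ?x0 v ?a w ?b" by (auto simp: offset_def)
  have s: "(sin \<theta>)\<^sup>2 = 1 - cos \<theta> * cos \<theta>" "1 - cos \<theta> * cos \<theta> \<noteq> 0"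
    using \<theta>(2) sin_squared_eq[of \<theta>] by (auto simp: power2_eq_square)
  show "form_with V \<Gamma> ?x0 v = 0" "form_with V \<Gamma> ?x0 w = 0"
    unfolding form_with_offset[OF V(1-3)] coxeter_form_sym[of \<Gamma> w v] \<theta>(1) s(1)
    using s(2) V(4) by (simp_all add: coxeter_form_def[of \<Gamma> v v] coxeter_form_def[of \<Gamma> w w] divide_simps)
      (simp_all add: algebra_simps)
qed

lemma reflections_relation:
  assumes V: "finite V" "v \<in> V" "w \<in> V" "v \<noteq> w" and m: "\<Gamma> {v, w} = enat m" "2 \<le> m"
  shows "((reflection V \<Gamma> w \<circ> reflection V \<Gamma> v) ^^ m) x = x"
proof -
  define \<theta> where "\<theta> = pi / real m"
  have "0 < \<theta>" "\<theta> < pi" using m(2) unfolding \<theta>_def by (auto simp: field_simps)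
  then have sin: "sin \<theta> \<noteq> 0" using sin_gt_zero by fastforce
  have form: "coxeter_form \<Gamma> v w = - cos \<theta>" using V(4) m(1) by (simp add: coxeter_form_def \<theta>_def)
  obtain x0 a b where x: "x = offset x0 v a w b" "form_with V \<Gamma> x0 v = 0" "form_with V \<Gamma> x0 w = 0"
    using orthogonal_decomposition[OF V form sin] by blast
  define r s where "r = b / sin \<theta>" and "s = - a / sin \<theta>"
  have "r * sin \<theta> = b" "s * sin \<theta> = - a" using sin by (simp_all add: r_def s_def)
  then have x': "x = offset x0 v (r * sin 0 + s * sin (0 - \<theta>)) w (r * sin (0 + \<theta>) + s * sin 0)"
    using x(1) by simp
  have full: "real m * (2 * \<theta>) = 2 * pi" using m(2) by (simp add: \<theta>_def)
  have "((reflection V \<Gamma> w \<circ> reflection V \<Gamma> v) ^^ m) x =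
    offset x0 v (r * sin (2 * pi) + s * sin (2 * pi - \<theta>)) w (r * sin (2 * pi + \<theta>) + s * sin (2 * pi))"
    by (subst x') (rule reflections_rotate[OF V x(2,3) form, of m r s, unfolded full])
  also have "\<dots> = offset x0 v (r * sin 0 + s * sin (0 - \<theta>)) w (r * sin (0 + \<theta>) + s * sin 0)"
    by (simp add: sin_add sin_diff)
  also have "\<dots> = x" by (rule x'[symmetric])
  finally show ?thesis .
qed

lemma word_action_Nil [simp]: "word_action V \<Gamma> [] x = x"
  by (simp add: word_action_def)

lemma word_action_Cons [simp]:
  "word_action V \<Gamma> (l # w) x = reflection V \<Gamma> (fst l) (word_action V \<Gamma> w x)"
  by (simp add: word_action_def)

lemma word_action_append [simp]:
  "word_action V \<Gamma> (u @ v) x = word_action V \<Gamma> u (word_action V \<Gamma> v x)"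
  by (simp add: word_action_def)

lemma word_action_power:
  "word_action V \<Gamma> (concat (replicate n w)) = word_action V \<Gamma> w ^^ n"
proof
  show "word_action V \<Gamma> (concat (replicate n w)) x = (word_action V \<Gamma> w ^^ n) x" for x
    by (induction n) auto
qed

context
  fixes V :: "'a set" and \<Gamma> :: "'a labelled_graph"
  assumes V: "finite V"
    and labels: "\<forall>e\<in>vertex_pairs V. 2 \<le> \<Gamma> e"
begin

lemma word_action_relator:
  assumes "r \<in> coxeter_relators V \<Gamma>"
  shows "word_action V \<Gamma> r x = x"
  using assms unfolding coxeter_relators_def
proof (elim UnE CollectE exE conjE)
  fix v assume "r = [(v, True), (v, True)]" "v \<in> V"
  then show ?thesis using reflection_involution[OF V] by simp
next
  fix v w m
  assume *: "r = concat (replicate m [(v, True), (w, True)])"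
    and vw: "v \<in> V" "w \<in> V" "v \<noteq> w" "\<Gamma> {v, w} = enat m"
  have "word_action V \<Gamma> [(v, True), (w, True)] = reflection V \<Gamma> v \<circ> reflection V \<Gamma> w"
    by (auto simp: fun_eq_iff)
  moreover have "2 \<le> m"
    using labels[rule_format, of "{v, w}"] vw by (simp add: vertex_pairs_def numeral_eq_enat)
  ultimately show ?thesis
    unfolding * word_action_power
    using reflections_relation[OF V vw(2,1) _ _ \<open>2 \<le> m\<close>] vw by (simp add: insert_commute)
qed

lemma word_action_well_defined:
  "pres_eq V (coxeter_relators V \<Gamma>) u v \<Longrightarrow> word_action V \<Gamma> u x = word_action V \<Gamma> v x"
  by (induction arbitrary: x rule: pres_eq.induct)
    (simp_all add: reflection_involution[OF V] word_action_relator)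

text \<open>
  For the label \<open>\<infinity>\<close> the form on the plane of \<open>a\<close> and \<open>c\<close> is degenerate with radical \<open>e\<^sub>a + e\<^sub>c\<close>, and
  \<open>a c\<close> acts on \<open>e\<^sub>a\<close> as the shear adding \<open>2 (e\<^sub>a + e\<^sub>c)\<close>.
\<close>
lemma infinite_dihedral_orbit:
  assumes "a \<in> V" "c \<in> V" "a \<noteq> c" "\<Gamma> {a, c} = \<infinity>"
  shows "(word_action V \<Gamma> [(a, True), (c, True)] ^^ n) (offset (\<lambda>_. 0) a 1 c 0) =
    offset (\<lambda>_. 0) a (2 * real n + 1) c (2 * real n)"
proof (induction n)
  case (Suc n)
  have f: "coxeter_form \<Gamma> a c = - 1" "coxeter_form \<Gamma> c a = - 1"
    using assms coxeter_form_sym[of \<Gamma> a c] by (simp_all add: coxeter_form_def)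
  have 0: "form_with V \<Gamma> (\<lambda>_. 0) v = 0" for v by (simp add: form_with_def)
  show ?case
    using Suc.IH reflection_offset[OF V assms(1,2,3) 0] reflection_offset[OF V assms(2,1) _ 0] assms(3)
    by (simp add: f offset_swap[of _ a _ c] algebra_simps)
qed simp

text \<open>
  The label \<open>2\<close> makes basis vectors orthogonal, as \<open>cos (\<pi> / 2) = 0\<close>.
\<close>
lemma commuting_dihedral_fixes:
  assumes "a \<in> V" "c \<in> V" "b \<in> V" "d \<in> V"
    and "\<Gamma> {a, b} = 2" "\<Gamma> {c, b} = 2" "\<Gamma> {a, d} = 2" "\<Gamma> {c, d} = 2"
    and "a \<noteq> b" "c \<noteq> b" "a \<noteq> d" "c \<noteq> d"
  shows "(word_action V \<Gamma> [(b, True), (d, True)] ^^ n) (offset (\<lambda>_. 0) a s c t) = offset (\<lambda>_. 0) a s c t"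
proof (induction n)
  case (Suc n)
  have "\<Gamma> {u, v} = 2 \<Longrightarrow> u \<noteq> v \<Longrightarrow> coxeter_form \<Gamma> u v = 0" for u v
    by (simp add: coxeter_form_def numeral_eq_enat)
  moreover have "form_with V \<Gamma> (\<lambda>_. 0) v = 0" for v by (simp add: form_with_def)
  ultimately have "form_with V \<Gamma> (offset (\<lambda>_. 0) a s c t) v = 0" if "v = b \<or> v = d" for v
    using that assms by (auto simp: form_with_offset[OF V assms(1,2)])
  then show ?case using Suc.IH by (simp add: reflection_fixes)
qed simp

end

section \<open>Induced squares in Coxeter groups\<close>
lemma (in group) involutions_commute:
  assumes "x \<in> carrier G" "y \<in> carrier G" "x \<otimes> x = \<one>" "y \<otimes> y = \<one>" "x \<otimes> y \<otimes> (x \<otimes> y) = \<one>"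
  shows "x \<otimes> y = y \<otimes> x"
proof -
  have "inv x = x" "inv y = y" "inv (x \<otimes> y) = x \<otimes> y"
    using assms by (auto intro: inv_equality)
  then show ?thesis using assms inv_mult_group[of x y] by simp
qed

definition word_class :: "'a set \<Rightarrow> 'a labelled_graph \<Rightarrow> 'a word \<Rightarrow> 'a word set" where
  "word_class V \<Gamma> w = pres_rel V (coxeter_relators V \<Gamma>) `` {w}"

lemma word_class_mult:
  "u \<in> words V \<Longrightarrow> v \<in> words V \<Longrightarrow>
    word_class V \<Gamma> u \<otimes>\<^bsub>coxeter_group V \<Gamma>\<^esub> word_class V \<Gamma> v = word_class V \<Gamma> (u @ v)"
  unfolding word_class_def coxeter_group_def by (rule presented_group_mult[OF coxeter_relators_words])

lemma word_class_one: "\<one>\<^bsub>coxeter_group V \<Gamma>\<^esub> = word_class V \<Gamma> []"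
  by (simp add: word_class_def coxeter_group_def presented_group_def)

lemma word_class_carrier: "w \<in> words V \<Longrightarrow> word_class V \<Gamma> w \<in> carrier (coxeter_group V \<Gamma>)"
  by (auto simp: word_class_def coxeter_group_def presented_group_def quotient_def)

lemma word_class_eq_iff:
  assumes "u \<in> words V" "v \<in> words V"
  shows "word_class V \<Gamma> u = word_class V \<Gamma> v \<longleftrightarrow> pres_eq V (coxeter_relators V \<Gamma>) u v"
  using eq_equiv_class_iff[OF equiv_pres_rel[OF coxeter_relators_words] assms]
  by (simp add: word_class_def pres_rel_def)

lemma word_class_relator:
  assumes "r \<in> coxeter_relators V \<Gamma>"
  shows "word_class V \<Gamma> r = \<one>\<^bsub>coxeter_group V \<Gamma>\<^esub>"
proof -
  have "r \<in> words V" using assms coxeter_relators_words by blast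
  moreover have "pres_eq V (coxeter_relators V \<Gamma>) r []"
    using pres_relator[of "[]" V "[]" r] assms by simp
  ultimately show ?thesis by (simp add: word_class_one word_class_eq_iff)
qed

lemma concat_replicate_words: "w \<in> words V \<Longrightarrow> concat (replicate n w) \<in> words V"
  by (induction n) auto

lemma word_class_pow:
  assumes "w \<in> words V"
  shows "word_class V \<Gamma> w [^]\<^bsub>coxeter_group V \<Gamma>\<^esub> n = word_class V \<Gamma> (concat (replicate n w))"
proof (induction n)
  case 0
  interpret group "coxeter_group V \<Gamma>" by (rule group_coxeter_group)
  show ?case by (simp add: word_class_one)
next
  case (Suc n)
  interpret group "coxeter_group V \<Gamma>" by (rule group_coxeter_group)
  have "word_class V \<Gamma> w [^]\<^bsub>coxeter_group V \<Gamma>\<^esub> Suc n =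
      word_class V \<Gamma> (concat (replicate n w)) \<otimes>\<^bsub>coxeter_group V \<Gamma>\<^esub> word_class V \<Gamma> w"
    using Suc by simp
  also have "\<dots> = word_class V \<Gamma> (concat (replicate n w) @ w)"
    by (rule word_class_mult[OF concat_replicate_words[OF assms] assms])
  also have "concat (replicate n w) @ w = concat (replicate (Suc n) w)"
    by (induction n) auto
  finally show ?case .
qed

definition induced_square :: "'a set \<Rightarrow> 'a labelled_graph \<Rightarrow> 'a \<Rightarrow> 'a \<Rightarrow> 'a \<Rightarrow> 'a \<Rightarrow> bool" where
  "induced_square V \<Gamma> a b c d \<longleftrightarrow> {a, b, c, d} \<subseteq> V \<and> distinct [a, b, c, d] \<and>
    \<Gamma> {a, b} = 2 \<and> \<Gamma> {b, c} = 2 \<and> \<Gamma> {c, d} = 2 \<and> \<Gamma> {d, a} = 2 \<and> \<Gamma> {a, c} = \<infinity> \<and> \<Gamma> {b, d} = \<infinity>"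

lemma generators_commute:
  assumes vw: "v \<in> V" "w \<in> V" "v \<noteq> w" "\<Gamma> {v, w} = 2"
  shows "word_class V \<Gamma> [(v, True)] \<otimes>\<^bsub>coxeter_group V \<Gamma>\<^esub> word_class V \<Gamma> [(w, True)] =
    word_class V \<Gamma> [(w, True)] \<otimes>\<^bsub>coxeter_group V \<Gamma>\<^esub> word_class V \<Gamma> [(v, True)]"
proof -
  interpret group "coxeter_group V \<Gamma>" by (rule group_coxeter_group)
  have sq: "[(u, True), (u, True)] \<in> coxeter_relators V \<Gamma>" if "u \<in> V" for u
    using that by (auto simp: coxeter_relators_def)
  have "\<Gamma> {v, w} = enat 2" using vw(4) by (simp add: numeral_eq_enat)
  then have "concat (replicate 2 [(v, True), (w, True)]) \<in> coxeter_relators V \<Gamma>"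
    using vw(1-3) unfolding coxeter_relators_def by blast
  then have "[(v, True), (w, True), (v, True), (w, True)] \<in> coxeter_relators V \<Gamma>"
    by (simp add: numeral_2_eq_2)
  then show ?thesis
    using vw by (intro involutions_commute) (simp_all add: word_class_carrier word_class_mult word_class_relator sq)
qed

text \<open>
  The element \<open>(a c)\<^sup>i (b d)\<^sup>j\<close> determines \<open>i\<close> through its action on \<open>e\<^sub>a\<close>, which \<open>b\<close> and \<open>d\<close> fix, and \<open>j\<close>
  through its action on \<open>e\<^sub>b\<close>, as \<open>a\<close> and \<open>c\<close> fix the plane of \<open>b\<close> and \<open>d\<close>.
\<close>
theorem induced_square_not_hyperbolic:
  assumes V: "finite V"
    and labels: "\<forall>e\<in>vertex_pairs V. 2 \<le> \<Gamma> e"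
    and square: "induced_square V \<Gamma> a b c d"
  shows "\<not> hyperbolic_group (coxeter_group V \<Gamma>)"
proof -
  interpret group "coxeter_group V \<Gamma>" by (rule group_coxeter_group)
  have sq: "a \<in> V" "b \<in> V" "c \<in> V" "d \<in> V" "a \<noteq> b" "b \<noteq> c" "c \<noteq> d" "d \<noteq> a" "a \<noteq> c" "b \<noteq> d"
    "\<Gamma> {a, b} = 2" "\<Gamma> {b, c} = 2" "\<Gamma> {c, d} = 2" "\<Gamma> {d, a} = 2" "\<Gamma> {a, c} = \<infinity>" "\<Gamma> {b, d} = \<infinity>"
    using square by (auto simp: induced_square_def)
  have sq': "b \<noteq> a" "c \<noteq> b" "d \<noteq> c" "a \<noteq> d" "\<Gamma> {b, a} = 2" "\<Gamma> {c, b} = 2" "\<Gamma> {d, c} = 2" "\<Gamma> {a, d} = 2"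
    using sq by (auto simp: insert_commute)
  let ?x = "\<lambda>v. word_class V \<Gamma> [(v, True)]"
  let ?u = "[(a, True), (c, True)]" and ?v = "[(b, True), (d, True)]"
  let ?g = "word_class V \<Gamma> ?u" and ?h = "word_class V \<Gamma> ?v"
  have words: "?u \<in> words V" "?v \<in> words V" using sq by simp_all
  have x: "?x a \<in> carrier (coxeter_group V \<Gamma>)" "?x b \<in> carrier (coxeter_group V \<Gamma>)"
    "?x c \<in> carrier (coxeter_group V \<Gamma>)" "?x d \<in> carrier (coxeter_group V \<Gamma>)"
    using sq by (auto intro: word_class_carrier)
  have gh: "?g = ?x a \<otimes>\<^bsub>coxeter_group V \<Gamma>\<^esub> ?x c" "?h = ?x b \<otimes>\<^bsub>coxeter_group V \<Gamma>\<^esub> ?x d"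
    using sq by (simp_all add: word_class_mult)
  have comm: "?g \<otimes>\<^bsub>coxeter_group V \<Gamma>\<^esub> ?h = ?h \<otimes>\<^bsub>coxeter_group V \<Gamma>\<^esub> ?g"
  proof -
    have ab: "?x a \<otimes>\<^bsub>coxeter_group V \<Gamma>\<^esub> ?x b = ?x b \<otimes>\<^bsub>coxeter_group V \<Gamma>\<^esub> ?x a"
      and cb: "?x c \<otimes>\<^bsub>coxeter_group V \<Gamma>\<^esub> ?x b = ?x b \<otimes>\<^bsub>coxeter_group V \<Gamma>\<^esub> ?x c"
      and cd: "?x c \<otimes>\<^bsub>coxeter_group V \<Gamma>\<^esub> ?x d = ?x d \<otimes>\<^bsub>coxeter_group V \<Gamma>\<^esub> ?x c"
      and ad: "?x a \<otimes>\<^bsub>coxeter_group V \<Gamma>\<^esub> ?x d = ?x d \<otimes>\<^bsub>coxeter_group V \<Gamma>\<^esub> ?x a"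
      using generators_commute[of _ V _ \<Gamma>] sq sq' by metis+
    have "?x c \<otimes>\<^bsub>coxeter_group V \<Gamma>\<^esub> (?x b \<otimes>\<^bsub>coxeter_group V \<Gamma>\<^esub> ?x d) =
        ?x b \<otimes>\<^bsub>coxeter_group V \<Gamma>\<^esub> ?x d \<otimes>\<^bsub>coxeter_group V \<Gamma>\<^esub> ?x c"
      using x cb cd by (metis m_assoc)
    moreover have "?x a \<otimes>\<^bsub>coxeter_group V \<Gamma>\<^esub> (?x b \<otimes>\<^bsub>coxeter_group V \<Gamma>\<^esub> ?x d) =
        ?x b \<otimes>\<^bsub>coxeter_group V \<Gamma>\<^esub> ?x d \<otimes>\<^bsub>coxeter_group V \<Gamma>\<^esub> ?x a"
      using x ab ad by (metis m_assoc)
    ultimately show ?thesis unfolding gh using x by (metis m_assoc m_closed)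
  qed
  let ?w = "\<lambda>i j. concat (replicate i ?u) @ concat (replicate j ?v)"
  have w: "?w i j \<in> words V" for i j
    using concat_replicate_words[OF words(1)] concat_replicate_words[OF words(2)] by simp
  have pow: "?g [^]\<^bsub>coxeter_group V \<Gamma>\<^esub> i \<otimes>\<^bsub>coxeter_group V \<Gamma>\<^esub> ?h [^]\<^bsub>coxeter_group V \<Gamma>\<^esub> j
      = word_class V \<Gamma> (?w i j)" for i j :: nat
    unfolding word_class_pow[OF words(1)] word_class_pow[OF words(2)]
    by (rule word_class_mult[OF concat_replicate_words[OF words(1)] concat_replicate_words[OF words(2)]])
  let ?e = "\<lambda>v s w t. offset (\<lambda>_. 0) v s w t"
  have act_a: "word_action V \<Gamma> (?w i j) (?e a 1 c 0) = ?e a (2 * real i + 1) c (2 * real i)" for i j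
    using commuting_dihedral_fixes[OF V labels, where a = a and b = b and c = c and d = d and n = j and s = 1 and t = 0]
      infinite_dihedral_orbit[OF V labels, where a = a and c = c and n = i] sq sq'
    by (simp add: word_action_power)
  have act_b: "word_action V \<Gamma> (?w i j) (?e b 1 d 0) = ?e b (2 * real j + 1) d (2 * real j)" for i j
    using commuting_dihedral_fixes[OF V labels, where a = b and b = a and c = d and d = c and n = i
        and s = "2 * real j + 1" and t = "2 * real j"]
      infinite_dihedral_orbit[OF V labels, where a = b and c = d and n = j] sq sq'
    by (simp add: word_action_power)
  have "i = k \<and> j = l" if "word_class V \<Gamma> (?w i j) = word_class V \<Gamma> (?w k l)" for i j k l
  proof -
    have "pres_eq V (coxeter_relators V \<Gamma>) (?w i j) (?w k l)"
      using that unfolding word_class_eq_iff[OF w w] .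
    then have act: "word_action V \<Gamma> (?w i j) y = word_action V \<Gamma> (?w k l) y" for y
      by (rule word_action_well_defined[OF V labels])
    have "?e a (2 * real i + 1) c (2 * real i) a = ?e a (2 * real k + 1) c (2 * real k) a"
      "?e b (2 * real j + 1) d (2 * real j) b = ?e b (2 * real l + 1) d (2 * real l) b"
      using act[of "?e a 1 c 0"] act[of "?e b 1 d 0"] unfolding act_a act_b by metis+
    then show ?thesis using sq by (simp add: offset_def)
  qed
  then have "inj (\<lambda>(i::nat, j::nat). ?g [^]\<^bsub>coxeter_group V \<Gamma>\<^esub> i \<otimes>\<^bsub>coxeter_group V \<Gamma>\<^esub> ?h [^]\<^bsub>coxeter_group V \<Gamma>\<^esub> j)"
    unfolding pow by (auto simp: inj_on_def)
  then show ?thesis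
    using not_hyperbolic_if_rank_two_abelian comm words word_class_carrier by blast
qed

section \<open>The second moment method for prescribed labels\<close>

text \<open>
  Chebyshev's inequality for the number of events that occur: if none occurs, this number differs
  from its mean by the mean.
\<close>
lemma measure_pmf_second_moment:
  fixes M :: "'a pmf" and A :: "'i \<Rightarrow> 'a set"
  assumes I: "finite I" and pos: "0 < (\<Sum>i\<in>I. measure M (A i))"
  shows "measure M {x. \<forall>i\<in>I. x \<notin> A i} \<le>
    (\<Sum>i\<in>I. \<Sum>j\<in>I. measure M (A i \<inter> A j) - measure M (A i) * measure M (A j)) /
    (\<Sum>i\<in>I. measure M (A i))\<^sup>2"
proof -
  let ?X = "\<lambda>x. \<Sum>i\<in>I. indicat_real (A i) x" and ?\<mu> = "\<Sum>i\<in>I. measure M (A i)"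
  have int: "integrable M (\<lambda>x. indicat_real B x)" for B
    by (rule measure_pmf.integrable_const_bound[of _ 1]) auto
  have X2: "(?X x)\<^sup>2 = (\<Sum>i\<in>I. \<Sum>j\<in>I. indicat_real (A i \<inter> A j) x)" for x
    by (simp add: power2_eq_square sum_product indicator_inter_arith)
  have EX: "measure_pmf.expectation M ?X = ?\<mu>"
    using int by (simp add: Bochner_Integration.integral_sum)
  have intX: "integrable M ?X" "integrable M (\<lambda>x. (?X x)\<^sup>2)"
    unfolding X2 using int by (auto intro!: Bochner_Integration.integrable_sum)
  have EX2: "measure_pmf.expectation M (\<lambda>x. (?X x)\<^sup>2) = (\<Sum>i\<in>I. \<Sum>j\<in>I. measure M (A i \<inter> A j))"
    unfolding X2 using int by (simp add: Bochner_Integration.integral_sum)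
  have var: "measure_pmf.variance M ?X =
      (\<Sum>i\<in>I. \<Sum>j\<in>I. measure M (A i \<inter> A j) - measure M (A i) * measure M (A j))"
    using measure_pmf.variance_eq[OF intX] EX EX2
    by (simp add: sum_subtractf sum_product power2_eq_square)
  have "measure M {x. \<forall>i\<in>I. x \<notin> A i} \<le> measure M {x \<in> space M. \<bar>?X x - measure_pmf.expectation M ?X\<bar> \<ge> ?\<mu>}"
    unfolding EX using pos by (intro measure_pmf.finite_measure_mono) auto
  also have "\<dots> \<le> measure_pmf.variance M ?X / ?\<mu>\<^sup>2"
    by (rule measure_pmf.Chebyshev_inequality[OF _ intX(2) pos]) simp
  finally show ?thesis unfolding var .
qed

lemma measure_Pi_pmf_pattern:
  assumes "finite A" "F \<subseteq> A"
  shows "measure (Pi_pmf A d P) {f. \<forall>e\<in>F. f e = l e} = (\<Prod>e\<in>F. pmf (P e) (l e))"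
proof -
  have "{f. \<forall>e\<in>F. f e = l e} = Pi A (\<lambda>e. if e \<in> F then {l e} else UNIV)"
    using assms(2) by (auto simp: Pi_def split: if_splits)
  then have "measure (Pi_pmf A d P) {f. \<forall>e\<in>F. f e = l e} =
      (\<Prod>e\<in>A. measure (P e) (if e \<in> F then {l e} else UNIV))"
    using measure_Pi_pmf_Pi[OF assms(1)] by simp
  also have "\<dots> = (\<Prod>e\<in>F. pmf (P e) (l e))"
    using assms by (intro prod.mono_neutral_cong_right) (auto simp: measure_pmf_single)
  finally show ?thesis .
qed

text \<open>
  The events are that all coordinates in \<open>F i\<close> have the values prescribed by \<open>l\<close>. As \<open>l\<close> does not
  depend on \<open>i\<close>, the intersection of two such events is an event of the same kind for
  \<open>F i \<union> F j\<close>, of probability \<open>q\<^sup>2\<close> divided by the weight of \<open>F i \<inter> F j\<close>. Disjoint index sets give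
  independent events and no covariance, so only the sum of the inverse weights of the nonempty
  overlaps enters.
\<close>
lemma pattern_second_moment:
  fixes F :: "'i \<Rightarrow> 'e set" and c :: real
  assumes A: "finite A" "\<And>i. i \<in> I \<Longrightarrow> F i \<subseteq> A" and I: "finite I" "I \<noteq> {}"
    and weight: "\<And>i. i \<in> I \<Longrightarrow> (\<Prod>e\<in>F i. pmf (P e) (l e)) = q" and pos: "\<And>e. 0 < pmf (P e) (l e)"
    and overlap: "\<And>i. i \<in> I \<Longrightarrow>
      (\<Sum>j | j \<in> I \<and> F i \<inter> F j \<noteq> {}. 1 / (\<Prod>e\<in>F i \<inter> F j. pmf (P e) (l e))) \<le> c * card I"
  shows "measure (Pi_pmf A d P) {f. \<forall>i\<in>I. \<not> (\<forall>e\<in>F i. f e = l e)} \<le> c"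
proof -
  let ?M = "Pi_pmf A d P" and ?E = "\<lambda>i. {f. \<forall>e\<in>F i. f e = l e}"
  let ?w = "\<lambda>B. \<Prod>e\<in>B. pmf (P e) (l e)"
  have fin: "finite (F i)" if "i \<in> I" for i using finite_subset[OF A(2)[OF that] A(1)] .
  have wpos: "0 < ?w B" for B using pos by (simp add: prod_pos)
  have q: "0 < q" using wpos weight I(2) by fastforce
  have E: "measure ?M (?E i) = q" if "i \<in> I" for i
    using measure_Pi_pmf_pattern[OF A(1) A(2)[OF that], of d P l] weight[OF that] by simp
  have EE: "measure ?M (?E i \<inter> ?E j) = q * q / ?w (F i \<inter> F j)" if "i \<in> I" "j \<in> I" for i j
  proof -
    have "?E i \<inter> ?E j = {f. \<forall>e\<in>F i \<union> F j. f e = l e}" by auto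
    then have "measure ?M (?E i \<inter> ?E j) = ?w (F i \<union> F j)"
      using measure_Pi_pmf_pattern[OF A(1), of "F i \<union> F j" d P l] A(2) that by simp
    moreover have "?w (F i \<union> F j) * ?w (F i \<inter> F j) = q * q"
      using prod.union_inter[OF fin[OF that(1)] fin[OF that(2)], of "\<lambda>e. pmf (P e) (l e)"]
      by (simp only: weight[OF that(1)] weight[OF that(2)])
    ultimately show ?thesis using wpos[of "F i \<inter> F j"] by (simp add: field_simps)
  qed
  have cov: "(\<Sum>j\<in>I. measure ?M (?E i \<inter> ?E j) - measure ?M (?E i) * measure ?M (?E j)) \<le> q\<^sup>2 * (c * card I)"
    if i: "i \<in> I" for i
  proof -
    let ?J = "{j. j \<in> I \<and> F i \<inter> F j \<noteq> {}}"
    have "(\<Sum>j\<in>I. measure ?M (?E i \<inter> ?E j) - measure ?M (?E i) * measure ?M (?E j)) \<le>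
        (\<Sum>j\<in>I. if F i \<inter> F j \<noteq> {} then q\<^sup>2 * (1 / ?w (F i \<inter> F j)) else 0)"
      using i q by (intro sum_mono) (auto simp: E EE power2_eq_square)
    also have "\<dots> = (\<Sum>j\<in>?J. q\<^sup>2 * (1 / ?w (F i \<inter> F j)))"
      using I(1) by (intro sum.mono_neutral_cong_right) auto
    also have "\<dots> = q\<^sup>2 * (\<Sum>j\<in>?J. 1 / ?w (F i \<inter> F j))"
      by (simp only: sum_distrib_left)
    also have "\<dots> \<le> q\<^sup>2 * (c * card I)"
      using overlap[OF i] by (intro mult_left_mono) auto
    finally show ?thesis .
  qed
  have card: "0 < card I" using I by (simp add: card_gt_0_iff)
  have EX: "(\<Sum>i\<in>I. measure ?M (?E i)) = real (card I) * q" using E by simp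
  have "measure ?M {f. \<forall>i\<in>I. f \<notin> ?E i} \<le>
    (\<Sum>i\<in>I. \<Sum>j\<in>I. measure ?M (?E i \<inter> ?E j) - measure ?M (?E i) * measure ?M (?E j)) /
      (\<Sum>i\<in>I. measure ?M (?E i))\<^sup>2"
    using measure_pmf_second_moment[OF I(1), of ?M ?E] EX card q by simp
  also have "\<dots> \<le> (\<Sum>i\<in>I. q\<^sup>2 * (c * card I)) / (real (card I) * q)\<^sup>2"
    unfolding EX by (intro divide_right_mono sum_mono cov) auto
  also have "\<dots> = c"
    using card q by (simp add: power2_eq_square field_simps)
  finally show ?thesis by simp
qed

lemma finite_vertex_pairs: "finite V \<Longrightarrow> finite (vertex_pairs V)"
  unfolding vertex_pairs_def by (rule finite_subset[of _ "Pow V"]) auto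

lemma vertex_pairs_mono: "U \<subseteq> V \<Longrightarrow> vertex_pairs U \<subseteq> vertex_pairs V"
  by (auto simp: vertex_pairs_def)

lemma vertex_pairs_Int: "vertex_pairs U \<inter> vertex_pairs V = vertex_pairs (U \<inter> V)"
  by (auto simp: vertex_pairs_def)

lemma vertex_pairs_image:
  assumes "inj_on f V"
  shows "vertex_pairs (f ` V) = (`) f ` vertex_pairs V"
proof (intro subset_antisym subsetI)
  fix e assume "e \<in> vertex_pairs (f ` V)"
  then obtain U where U: "U \<subseteq> V" "e = f ` U" "card (f ` U) = 2"
    unfolding vertex_pairs_def by (auto simp: subset_image_iff)
  then show "e \<in> (`) f ` vertex_pairs V"
    using card_image[OF inj_on_subset[OF assms U(1)]] by (auto simp: vertex_pairs_def)
next
  fix e assume "e \<in> (`) f ` vertex_pairs V"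
  then obtain U where U: "U \<subseteq> V" "e = f ` U" "card U = 2" by (auto simp: vertex_pairs_def)
  then show "e \<in> vertex_pairs (f ` V)"
    using card_image[OF inj_on_subset[OF assms U(1)]] by (auto simp: vertex_pairs_def)
qed

lemma prod_vertex_pairs_insert:
  assumes "finite V" "v \<notin> V"
  shows "(\<Prod>e\<in>vertex_pairs (insert v V). g e) = (\<Prod>u\<in>V. g {v, u}) * (\<Prod>e\<in>vertex_pairs V. g e)"
proof -
  have "vertex_pairs (insert v V) = (\<lambda>u. {v, u}) ` V \<union> vertex_pairs V"
  proof (intro subset_antisym subsetI)
    fix e assume "e \<in> vertex_pairs (insert v V)"
    then show "e \<in> (\<lambda>u. {v, u}) ` V \<union> vertex_pairs V"
      using assms(2) by (auto simp: vertex_pairs_def card_2_iff)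
  next
    fix e assume "e \<in> (\<lambda>u. {v, u}) ` V \<union> vertex_pairs V"
    then show "e \<in> vertex_pairs (insert v V)" using assms(2) by (auto simp: vertex_pairs_def card_2_iff)
  qed
  moreover have "(\<lambda>u. {v, u}) ` V \<inter> vertex_pairs V = {}" using assms(2) by (auto simp: vertex_pairs_def)
  moreover have "inj_on (\<lambda>u. {v, u}) V" by (auto simp: inj_on_def doubleton_eq_iff)
  ultimately show ?thesis
    using assms(1) by (simp add: prod.union_disjoint finite_vertex_pairs prod.reindex)
qed

lemma vertex_pairs_trivial:
  assumes "finite V" "card V < 2"
  shows "vertex_pairs V = {}"
proof -
  have "card e \<noteq> 2" if "e \<subseteq> V" for e using card_mono[OF assms(1) that] assms(2) by simp
  then show ?thesis by (auto simp: vertex_pairs_def)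
qed

section \<open>Induced squares in random graphs\<close>

text \<open>
  The vertex set is split into residue classes modulo \<open>4\<close>, and only quadruples with one vertex in
  each class, in cyclic order, are tried. The label that a pair must have is then a function of the
  pair alone: sides join classes of different parity, diagonals classes of equal parity. Two
  overlapping quadruples therefore never make contradictory demands on a pair.
\<close>
definition square_label :: "nat set \<Rightarrow> enat" where
  "square_label e = (if even (\<Sum>e) then \<infinity> else 2)"

definition square_vertex :: "(nat \<Rightarrow> nat) \<Rightarrow> nat \<Rightarrow> nat" where
  "square_vertex t i = 4 * t i + i"

lemma square_vertex_eq_iff:
  "i < 4 \<Longrightarrow> j < 4 \<Longrightarrow> square_vertex t i = square_vertex t' j \<longleftrightarrow> i = j \<and> t i = t' j"
  unfolding square_vertex_def by presburger

lemma inj_on_square_vertex: "S \<subseteq> {..<4} \<Longrightarrow> inj_on (square_vertex t) S"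
  by (rule inj_onI) (auto simp: subset_iff square_vertex_eq_iff)

lemma square_label_image:
  assumes "S \<subseteq> {..<4}" "e \<in> vertex_pairs S"
  shows "square_label (square_vertex t ` e) = square_label e"
proof -
  have "e \<subseteq> {..<4}" using assms by (auto simp: vertex_pairs_def)
  then have "\<Sum>(square_vertex t ` e) = (\<Sum>i\<in>e. square_vertex t i)"
    using sum.reindex[OF inj_on_square_vertex] by simp
  also have "\<dots> = 4 * (\<Sum>i\<in>e. t i) + \<Sum>e"
    by (simp add: square_vertex_def sum.distrib sum_distrib_left)
  finally show ?thesis by (simp add: square_label_def)
qed

lemma prod_square_image:
  assumes "S \<subseteq> {..<4}"
  shows "(\<Prod>e\<in>vertex_pairs (square_vertex t ` S). g (square_label e)) =
    (\<Prod>e\<in>vertex_pairs S. g (square_label e))"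
proof -
  have "inj_on ((`) (square_vertex t)) (vertex_pairs S)"
    using inj_on_image_Pow[OF inj_on_square_vertex[OF assms]]
    by (rule inj_on_subset) (auto simp: vertex_pairs_def)
  then show ?thesis
    unfolding vertex_pairs_image[OF inj_on_square_vertex[OF assms]]
    using square_label_image[OF assms] by (simp add: prod.reindex)
qed

text \<open>
  Up to the order of the factors, the weight of \<open>S\<close> is \<open>x\<close> or \<open>y\<close> for two vertices, \<open>x\<^sup>2 y\<close> for three,
  and \<open>x\<^sup>4 y\<^sup>2\<close> for four, where \<open>x\<close> and \<open>y\<close> are the weights of a side and a diagonal. For two and three
  vertices the bound follows from \<open>x, y \<le> 1 \<le> m\<close>; for four vertices the right-hand side is the
  square of the left-hand side, which is at least \<open>1\<close>.
\<close>
lemma square_weight_bound: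
  fixes g :: "enat \<Rightarrow> real"
  assumes m: "1 \<le> m" and g: "0 \<le> g 2" "g 2 \<le> 1" "0 \<le> g \<infinity>" "g \<infinity> \<le> 1"
    and r: "1 \<le> m\<^sup>2 * (g 2)\<^sup>2 * g \<infinity>"
    and S: "S \<subseteq> {..<4}" "2 \<le> card S"
  shows "m\<^sup>2 * (g 2)\<^sup>2 * g \<infinity> \<le> m ^ card S * (\<Prod>e\<in>vertex_pairs S. g (square_label e))"
proof -
  define x y where "x = g 2" and "y = g \<infinity>"
  have xy: "0 \<le> x" "x \<le> 1" "0 \<le> y" "y \<le> 1" "1 \<le> m\<^sup>2 * x\<^sup>2 * y" using g r by (simp_all add: x_def y_def)
  have "x\<^sup>2 * y \<le> x" "x\<^sup>2 * y \<le> y"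
    using xy by (auto simp: power2_eq_square intro: mult_left_le_one_le mult_right_le_one_le mult_le_one
        order_trans[OF mult_right_le_one_le])
  then have 2: "m\<^sup>2 * x\<^sup>2 * y \<le> m\<^sup>2 * x" "m\<^sup>2 * x\<^sup>2 * y \<le> m\<^sup>2 * y"
    using m by (simp_all add: mult.assoc mult_left_mono)
  have "m\<^sup>2 * (x\<^sup>2 * y) \<le> m ^ 3 * (x\<^sup>2 * y)"
    using m xy by (intro mult_right_mono power_increasing) auto
  then have 3: "m\<^sup>2 * x\<^sup>2 * y \<le> m ^ 3 * (x\<^sup>2 * y)" by (simp add: mult.assoc)
  have "m\<^sup>2 * x\<^sup>2 * y * 1 \<le> (m\<^sup>2 * x\<^sup>2 * y) * (m\<^sup>2 * x\<^sup>2 * y)"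
    using xy by (intro mult_left_mono) auto
  then have 4: "m\<^sup>2 * x\<^sup>2 * y \<le> m ^ 4 * (x ^ 4 * y\<^sup>2)" by (simp add: power_def numeral_eq_Suc algebra_simps)
  let ?W = "\<lambda>S. \<Prod>e\<in>vertex_pairs S. g (square_label e)"
  have empty: "vertex_pairs {} = {}" by (simp add: vertex_pairs_trivial)
  have W: "?W {0, 1} = x" "?W {0, 2} = y" "?W {0, 3} = x" "?W {1, 2} = x" "?W {1, 3} = y" "?W {2, 3} = x"
    "?W {0, 1, 2} = x\<^sup>2 * y" "?W {0, 1, 3} = x\<^sup>2 * y" "?W {0, 2, 3} = x\<^sup>2 * y" "?W {1, 2, 3} = x\<^sup>2 * y"
    "?W {0, 1, 2, 3} = x ^ 4 * y\<^sup>2"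
    by (simp_all add: prod_vertex_pairs_insert empty square_label_def x_def y_def power2_eq_square power4_eq_xxxx)
  have "S \<in> Pow {0, 1, 2, 3}" using S(1) by auto
  also have "Pow {0, 1, 2, 3} = {{}, {0}, {1}, {2}, {3}, {0, 1}, {0, 2}, {0, 3}, {1, 2}, {1, 3}, {2, 3},
      {0, 1, 2}, {0, 1, 3}, {0, 2, 3}, {1, 2, 3}, {0, 1, 2, 3 :: nat}}"
    unfolding Pow_insert Pow_empty by (simp add: image_insert insert_commute Un_insert_left)
  finally show ?thesis
    unfolding x_def[symmetric] y_def[symmetric]
    using S(2) 2 3 4 by (elim insertE emptyE; simp only: W; simp add: power2_eq_square power3_eq_cube power4_eq_xxxx mult.assoc)
qed

lemma card_agreeing:
  assumes t: "t \<in> {..<k::nat} \<rightarrow>\<^sub>E {..<m::nat}" and S: "S \<subseteq> {..<k}"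
  shows "card {t' \<in> {..<k} \<rightarrow>\<^sub>E {..<m}. {i \<in> {..<k}. t i = t' i} = S} \<le> m ^ (k - card S)"
proof -
  let ?B = "\<lambda>i. if i \<in> S then {t i} else {..<m}"
  have "card {t' \<in> {..<k} \<rightarrow>\<^sub>E {..<m}. {i \<in> {..<k}. t i = t' i} = S} \<le> card (Pi\<^sub>E {..<k} ?B)"
    by (intro card_mono finite_PiE) (auto simp: PiE_iff extensional_def)
  also have "\<dots> = (\<Prod>i<k. if i \<in> S then 1 else m)"
    by (simp add: card_PiE if_distrib cong: if_cong)
  also have "\<dots> = m ^ card ({..<k} \<inter> - S)"
    by (simp add: prod.If_cases)
  also have "card ({..<k} \<inter> - S) = k - card S"
    using card_Diff_subset[OF finite_subset[OF S] S] by (simp add: Diff_eq)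
  finally show ?thesis .
qed

lemma square_agreement:
  "square_vertex t ` {..<4} \<inter> square_vertex t' ` {..<4} = square_vertex t ` {i \<in> {..<4}. t i = t' i}"
  by (auto simp: square_vertex_eq_iff) (auto simp: square_vertex_def)

text \<open>
  The quadruples \<open>t'\<close> are sorted by the set \<open>S\<close> of coordinates in which they agree with \<open>t\<close>. At most
  \<open>m ^ (4 - |S|)\<close> of them belong to \<open>S\<close>, so \<open>S\<close> contributes at most
  \<open>m\<^sup>4 / (m ^ |S| W S) \<le> m\<^sup>4 / r\<close>; there are at most \<open>16\<close> such sets.
\<close>
lemma square_overlap_sum:
  fixes g :: "enat \<Rightarrow> real"
  assumes m: "1 \<le> m" and g: "0 < g 2" "g 2 \<le> 1" "0 < g \<infinity>" "g \<infinity> \<le> 1"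
    and r: "r = (real m)\<^sup>2 * (g 2)\<^sup>2 * g \<infinity>" "1 \<le> r"
    and t: "t \<in> {..<4} \<rightarrow>\<^sub>E {..<m}"
  defines "F \<equiv> \<lambda>t. vertex_pairs (square_vertex t ` {..<4})"
  shows "(\<Sum>t' | t' \<in> {..<4} \<rightarrow>\<^sub>E {..<m} \<and> F t \<inter> F t' \<noteq> {}. 1 / (\<Prod>e\<in>F t \<inter> F t'. g (square_label e)))
    \<le> 16 / r * card ({..<4::nat} \<rightarrow>\<^sub>E {..<m})"
proof -
  let ?I = "{..<4::nat} \<rightarrow>\<^sub>E {..<m}"
  let ?J = "{t'. t' \<in> ?I \<and> F t \<inter> F t' \<noteq> {}}"
  let ?W = "\<lambda>S. \<Prod>e\<in>vertex_pairs S. g (square_label e)"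
  let ?ag = "\<lambda>t'. {i \<in> {..<4}. t i = t' i}"
  let ?T = "{S. S \<subseteq> {..<4::nat} \<and> 2 \<le> card S}"
  have finI: "finite ?I" by (intro finite_PiE) auto
  have finT: "finite ?T" by (rule finite_subset[of _ "Pow {..<4}"]) auto
  have F: "F t \<inter> F t' = vertex_pairs (square_vertex t ` ?ag t')" for t'
    unfolding F_def vertex_pairs_Int square_agreement ..
  have W: "(\<Prod>e\<in>F t \<inter> F t'. g (square_label e)) = ?W (?ag t')" for t'
    unfolding F by (rule prod_square_image) auto
  have Wpos: "0 < ?W S" for S
    using g by (intro prod_pos) (auto simp: square_label_def)
  have ag: "?ag ` ?J \<subseteq> ?T"
  proof
    fix S assume "S \<in> ?ag ` ?J"
    then obtain t' where t': "S = ?ag t'" "F t \<inter> F t' \<noteq> {}" by blast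
    have "card (square_vertex t ` S) = card S"
      using t'(1) by (intro card_image inj_on_square_vertex) auto
    then have "2 \<le> card S"
      using t' vertex_pairs_trivial[of "square_vertex t ` S"] unfolding F by fastforce
    then show "S \<in> ?T" using t'(1) by auto
  qed
  have fibre: "(\<Sum>t' | t' \<in> ?J \<and> ?ag t' = S. 1 / ?W (?ag t')) \<le> real m ^ 4 / r" if S: "S \<in> ?T" for S
  proof -
    have c4: "card S \<le> 4" using card_mono[of "{..<4::nat}" S] S by simp
    have "(\<Sum>t' | t' \<in> ?J \<and> ?ag t' = S. 1 / ?W (?ag t')) = card {t'. t' \<in> ?J \<and> ?ag t' = S} / ?W S"
      by simp
    also have "\<dots> \<le> real (m ^ (4 - card S)) / ?W S"
    proof (intro divide_right_mono)
      have "card {t'. t' \<in> ?J \<and> ?ag t' = S} \<le> card {t' \<in> ?I. ?ag t' = S}"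
        using finI by (intro card_mono) auto
      also have "\<dots> \<le> m ^ (4 - card S)" using card_agreeing[OF t] S by simp
      finally show "real (card {t'. t' \<in> ?J \<and> ?ag t' = S}) \<le> real (m ^ (4 - card S))"
        by (simp only: of_nat_le_iff)
    qed (use Wpos[of S] in simp)
    also have "\<dots> \<le> real m ^ 4 / r"
    proof -
      have "r \<le> real m ^ card S * ?W S"
        unfolding r(1) using S m g r by (intro square_weight_bound) auto
      then have "real m ^ (4 - card S) * r \<le> real m ^ (4 - card S) * (real m ^ card S * ?W S)"
        by (intro mult_left_mono) auto
      also have "\<dots> = real m ^ 4 * ?W S"
        using c4 by (simp add: mult.assoc[symmetric] power_add[symmetric])
      finally show ?thesis using Wpos[of S] r(2) by (simp add: field_simps)
    qed
    finally show ?thesis .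
  qed
  have "(\<Sum>t'\<in>?J. 1 / (\<Prod>e\<in>F t \<inter> F t'. g (square_label e))) = (\<Sum>t'\<in>?J. 1 / ?W (?ag t'))"
    unfolding W ..
  also have "\<dots> = (\<Sum>S\<in>?T. \<Sum>t' | t' \<in> ?J \<and> ?ag t' = S. 1 / ?W (?ag t'))"
    by (rule sum.group[symmetric]) (use finI finT ag in auto)
  also have "\<dots> \<le> (\<Sum>S\<in>?T. real m ^ 4 / r)"
    by (intro sum_mono fibre)
  also have "\<dots> = card ?T * (real m ^ 4 / r)" by simp
  also have "\<dots> \<le> 16 * (real m ^ 4 / r)"
  proof (intro mult_right_mono)
    have "card ?T \<le> card (Pow {..<4::nat})" by (intro card_mono) auto
    then show "real (card ?T) \<le> 16" by (simp add: card_Pow)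
  qed (use r in simp)
  also have "\<dots> = 16 / r * card ?I" by (simp add: card_PiE)
  finally show ?thesis .
qed

lemma induced_square_of_pattern:
  assumes t: "t \<in> {..<4} \<rightarrow>\<^sub>E {..<m}" and n: "4 * m \<le> n"
    and \<Gamma>: "\<forall>e\<in>vertex_pairs (square_vertex t ` {..<4}). \<Gamma> e = square_label e"
  shows "induced_square {..<n} \<Gamma> (square_vertex t 0) (square_vertex t 1) (square_vertex t 2) (square_vertex t 3)"
proof -
  have bound: "square_vertex t i < n" if "i < 4" for i
  proof -
    have "t i < m" using t that by (auto simp: PiE_iff)
    then show ?thesis using n that by (simp add: square_vertex_def)
  qed
  have label: "\<Gamma> {square_vertex t i, square_vertex t j} = square_label {i, j}"
    if "i < 4" "j < 4" "i \<noteq> j" for i j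
  proof -
    have ij: "{i, j} \<in> vertex_pairs {..<4}" using that by (auto simp: vertex_pairs_def)
    then have "square_vertex t ` {i, j} \<in> vertex_pairs (square_vertex t ` {..<4})"
      unfolding vertex_pairs_image[OF inj_on_square_vertex[OF subset_refl]] by (rule imageI)
    then have "\<Gamma> (square_vertex t ` {i, j}) = square_label {i, j}"
      using \<Gamma> square_label_image[OF subset_refl ij] by simp
    then show ?thesis by simp
  qed
  show ?thesis
    unfolding induced_square_def
    using label[of 0 1] label[of 1 2] label[of 2 3] label[of 3 0] label[of 0 2] label[of 1 3]
    by (auto simp: bound square_vertex_eq_iff square_label_def)
qed

lemma measure_no_square:
  fixes P :: "enat pmf"
  assumes pos: "0 < pmf P 2" "0 < pmf P \<infinity>" and n: "4 * m \<le> n"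
    and r: "r = (real m)\<^sup>2 * (pmf P 2)\<^sup>2 * pmf P \<infinity>" "1 \<le> r"
  shows "measure (Pi_pmf (vertex_pairs {..<n}) \<infinity> (\<lambda>_. P))
    {\<Gamma>. \<not> (\<exists>a b c d. induced_square {..<n} \<Gamma> a b c d)} \<le> 16 / r"
proof -
  let ?M = "Pi_pmf (vertex_pairs {..<n}) \<infinity> (\<lambda>_. P)" and ?I = "{..<4::nat} \<rightarrow>\<^sub>E {..<m}"
  let ?F = "\<lambda>t. vertex_pairs (square_vertex t ` {..<4})"
  have m: "1 \<le> m" using r by (cases m) auto
  have "measure ?M {\<Gamma>. \<not> (\<exists>a b c d. induced_square {..<n} \<Gamma> a b c d)} \<le>
      measure ?M {\<Gamma>. \<forall>t\<in>?I. \<not> (\<forall>e\<in>?F t. \<Gamma> e = square_label e)}"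
    using induced_square_of_pattern[OF _ n] by (intro measure_pmf.finite_measure_mono) (blast, simp)
  also have "\<dots> \<le> 16 / r"
  proof (rule pattern_second_moment[where I = ?I and F = ?F and l = square_label and P = "\<lambda>_. P"
        and q = "\<Prod>e\<in>vertex_pairs {..<4}. pmf P (square_label e)"])
    show "finite (vertex_pairs {..<n})" by (simp add: finite_vertex_pairs)
    show "?F t \<subseteq> vertex_pairs {..<n}" if "t \<in> ?I" for t
    proof (rule vertex_pairs_mono)
      have "square_vertex t i < n" if "i < 4" for i
      proof -
        have "t i < m" using \<open>t \<in> ?I\<close> that by (auto simp: PiE_iff)
        then show ?thesis using n that by (simp add: square_vertex_def)
      qed
      then show "square_vertex t ` {..<4} \<subseteq> {..<n}" by auto
    qed
    show "finite ?I" by (intro finite_PiE) auto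
    show "?I \<noteq> {}" using m by (auto simp: PiE_eq_empty_iff lessThan_empty_iff)
    show "(\<Prod>e\<in>?F t. pmf P (square_label e)) = (\<Prod>e\<in>vertex_pairs {..<4}. pmf P (square_label e))" for t
      by (rule prod_square_image) simp
    show "0 < pmf P (square_label e)" for e using pos by (simp add: square_label_def)
    show "(\<Sum>t' | t' \<in> ?I \<and> ?F t \<inter> ?F t' \<noteq> {}. 1 / (\<Prod>e\<in>?F t \<inter> ?F t'. pmf P (square_label e)))
      \<le> 16 / r * card ?I" if "t \<in> ?I" for t
      using m pos pmf_le_1 r that by (intro square_overlap_sum) auto
  qed
  finally show ?thesis .
qed

text \<open>
  The representation is constructed for labels \<open>\<ge> 2\<close> only; the labels \<open>0\<close> and \<open>1\<close> have probability zero.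
\<close>
lemma label_ge_2:
  assumes q: "label_probs q" and l: "l \<in> set_pmf (label_pmf q)"
  shows "2 \<le> l"
proof -
  have "label_prob q l \<noteq> 0" using l pmf_label_pmf[OF q] by (simp add: set_pmf_iff)
  then show ?thesis by (cases l) (auto simp: label_prob_def numeral_eq_enat split: if_splits)
qed

lemma prob_not_hyperbolic:
  assumes q: "label_probs q" and pos: "0 < q 2" "0 < p_infinity q" and n: "4 * m \<le> n"
    and r: "r = (real m)\<^sup>2 * (q 2)\<^sup>2 * p_infinity q" "1 \<le> r"
  shows "1 - 16 / r \<le> measure (random_labelled_graph n q)
    {\<Gamma>. \<not> hyperbolic_group (coxeter_group {..<n} \<Gamma>)}"
proof -
  let ?M = "random_labelled_graph n q" and ?S = "{\<Gamma>. \<exists>a b c d. induced_square {..<n} \<Gamma> a b c d}"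
  have pmf: "pmf (label_pmf q) 2 = q 2" "pmf (label_pmf q) \<infinity> = p_infinity q"
    using pmf_label_pmf[OF q] by (simp_all add: label_prob_def numeral_eq_enat)
  have compl: "- ?S = {\<Gamma>. \<not> (\<exists>a b c d. induced_square {..<n} \<Gamma> a b c d)}" by blast
  have "measure ?M (- ?S) \<le> 16 / r"
    using measure_no_square[of "label_pmf q" m n r] pos n r
    unfolding random_labelled_graph_def pmf compl by simp
  then have "1 - 16 / r \<le> measure ?M ?S"
    using measure_pmf.prob_compl[of ?S ?M] by (simp add: Compl_eq_Diff_UNIV)
  also have "\<dots> \<le> measure ?M {\<Gamma>. \<not> hyperbolic_group (coxeter_group {..<n} \<Gamma>)}"
  proof (rule measure_pmf.finite_measure_mono_AE)
    have "\<forall>\<Gamma>\<in>set_pmf ?M. \<forall>e\<in>vertex_pairs {..<n}. 2 \<le> \<Gamma> e"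
      using label_ge_2[OF q] unfolding random_labelled_graph_def
      by (auto simp: set_Pi_pmf finite_vertex_pairs PiE_dflt_def)
    then show "AE \<Gamma> in ?M. \<Gamma> \<in> ?S \<longrightarrow> \<Gamma> \<in> {\<Gamma>. \<not> hyperbolic_group (coxeter_group {..<n} \<Gamma>)}"
      using induced_square_not_hyperbolic[of "{..<n}"] by (auto simp: AE_measure_pmf_iff)
  qed auto
  finally show ?thesis .
qed

theorem theorem6:
  fixes p :: "nat \<Rightarrow> nat \<Rightarrow> real"
  assumes "\<And>n. label_probs (p n)"
    and "filterlim (\<lambda>n. real n ^ 4 * p n 2 ^ 4 * p_infinity (p n) ^ 2) at_top sequentially"
  shows "(\<lambda>n. measure_pmf.prob (random_labelled_graph n (p n))
      {\<Gamma>. \<not> hyperbolic_group (coxeter_group {..<n} \<Gamma>)}) \<longlonglongrightarrow> 1"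
proof -
  let ?Q = "\<lambda>n. real n ^ 4 * p n 2 ^ 4 * p_infinity (p n) ^ 2"
  have nonneg: "0 \<le> p n 2" "0 \<le> p_infinity (p n)" for n
    using assms(1)[of n] by (simp_all add: label_probs_def p_infinity_def)
  have "1 - 1024 / sqrt (?Q n) \<le> measure_pmf.prob (random_labelled_graph n (p n))
      {\<Gamma>. \<not> hyperbolic_group (coxeter_group {..<n} \<Gamma>)}" if n: "4 \<le> n" "4096 \<le> ?Q n" for n
  proof -
    define r where "r = (real (n div 4))\<^sup>2 * (p n 2)\<^sup>2 * p_infinity (p n)"
    have "?Q n = ((real n)\<^sup>2 * (p n 2)\<^sup>2 * p_infinity (p n))\<^sup>2"
      by (simp add: power_mult_distrib flip: power_mult)
    then have Q: "sqrt (?Q n) = (real n)\<^sup>2 * (p n 2)\<^sup>2 * p_infinity (p n)"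
      using nonneg by (simp add: real_sqrt_abs)
    \<comment> \<open>Squares are sought in \<open>n div 4\<close> blocks of four vertices. This costs a factor \<open>8\<^sup>2\<close> in \<open>r\<close>,
      whence \<open>4096 = 64\<^sup>2\<close> and \<open>1024 = 16 * 64\<close>.\<close>
    have "n \<le> 8 * (n div 4)" using n(1) by presburger
    then have "real n \<le> 8 * real (n div 4)" by linarith
    then have "(real n)\<^sup>2 \<le> (8 * real (n div 4))\<^sup>2" by (rule power_mono) simp
    then have le: "(real n)\<^sup>2 * ((p n 2)\<^sup>2 * p_infinity (p n)) \<le>
        (8 * real (n div 4))\<^sup>2 * ((p n 2)\<^sup>2 * p_infinity (p n))"
      using nonneg by (intro mult_right_mono) auto
    define s where "s = sqrt (?Q n)"
    have "s \<le> 64 * r"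
      using le unfolding s_def Q r_def by (simp add: power_mult_distrib mult.assoc)
    moreover have "64 \<le> s"
      unfolding s_def using n(2) by (intro real_le_rsqrt) simp
    ultimately have r: "1 \<le> r" "16 / r \<le> 1024 / s" by (simp_all add: field_simps)
    have "p n 2 \<noteq> 0" "p_infinity (p n) \<noteq> 0" using r(1) unfolding r_def by auto
    then have "1 - 16 / r \<le> measure_pmf.prob (random_labelled_graph n (p n))
        {\<Gamma>. \<not> hyperbolic_group (coxeter_group {..<n} \<Gamma>)}"
      using nonneg[of n] r(1) by (intro prob_not_hyperbolic[OF assms(1) _ _ _ r_def]) auto
    then show ?thesis using r(2) unfolding s_def by linarith
  qed
  moreover have "eventually (\<lambda>n. 4 \<le> n \<and> 4096 \<le> ?Q n) sequentially"
    using assms(2) eventually_ge_at_top[of 4] unfolding filterlim_at_top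
    by (auto intro: eventually_conj)
  ultimately have lower: "eventually (\<lambda>n. 1 - 1024 / sqrt (?Q n) \<le>
      measure_pmf.prob (random_labelled_graph n (p n))
        {\<Gamma>. \<not> hyperbolic_group (coxeter_group {..<n} \<Gamma>)}) sequentially"
    by (auto elim: eventually_mono)
  have "filterlim (\<lambda>n. sqrt (?Q n)) at_top sequentially"
    by (rule filterlim_compose[OF sqrt_at_top assms(2)])
  then have "(\<lambda>n. 1024 / sqrt (?Q n)) \<longlonglongrightarrow> 0"
    by (rule real_tendsto_divide_at_top[OF tendsto_const])
  then have "(\<lambda>n. 1 - 1024 / sqrt (?Q n)) \<longlonglongrightarrow> 1 - 0"
    by (intro tendsto_diff tendsto_const)
  then show ?thesis
    using lower by (intro tendsto_sandwich[OF lower _ _ tendsto_const]) auto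
qed

end
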